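(* Let $q\in\mathbf{C}$, $|q|>1$, let $U\subset\mathbf{C}^*$ be an open set with $q^{-1}U\subset U$, and let $f:U\to\mathbf{C}$ be a function. Then $f$ is holomorphic and admits a $q$-asymptotic expansion on $U$ (i.e. $f\in\mathscr{A}(U)$) if and only if, for every invariant strict subset $K\subset U$, $$f_{|K}\in\mathrm{Ker}\left(\frac{\partial}{\partial\bar z}:\mathcal{C}^\infty_{Whitney}(K\cup\{0\},\mathbf{C})\to\mathcal{C}^\infty_{Whitney}(K\cup\{0\},\mathbf{C})\right),$$ i.e. $f_{|K}$ is the restriction to $K$ of the order zero component of an element of that kernel.
   Context: An invariant strict subset of $U$ is a set of the form $K=\bigcup_{n\ge0}q^{-n}K'$ with $K'\subset U$ compact; then $K\cup\{0\}$ is compact in $\mathbf{C}$. A holomorphic function $f$ on $U$ admits $\hat f=\sum_{n\ge0}a_nz^n\in\mathbf{C}[[z]]$ as $q$-asymptotic expansion on $U$ if for every $n\in\mathbf{N}$ and every invariant strict subset $K\subset U$ the function $z^{-n}\bigl(f(z)-\sum_{p=0}^{n-1}a_pz^p\bigr)$ is bounded on $K$; $\mathscr{A}(U)$ is the set of holomorphic functions on $U$ admitting such an expansion. For a compact set $L\subset\mathbf{C}=\mathbf{R}^2$, $\mathcal{C}^\infty_{Whitney}(L,\mathbf{C})$ is the space of $\mathcal{C}^\infty$ functions in Whitney's sense on $L$: families $(f^{(k)})_{k\in\mathbf{N}^2}$ of continuous complex functions on $L$ which are the restrictions to $L$ of all the partial derivatives of one $\mathcal{C}^\infty$ function defined near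 $L$ (equivalently, by Whitney's theorem, satisfying Whitney's conditions of all orders). The derivation $\partial/\partial\bar z$ acts on such jets in the obvious way. *)

theory Defs
  imports "HOL-Complex_Analysis.Complex_Analysis"
begin

definition invariant_strict_subset :: "complex \<Rightarrow> complex set \<Rightarrow> complex set \<Rightarrow> bool" where
  "invariant_strict_subset q U K \<longleftrightarrow>
     (\<exists>K'. compact K' \<and> K' \<subseteq> U \<and> K = (\<Union>n::nat. (\<lambda>z. inverse q ^ n * z) ` K'))"

definition has_q_asymptotic_expansion ::
    "complex \<Rightarrow> complex set \<Rightarrow> (complex \<Rightarrow> complex) \<Rightarrow> complex fps \<Rightarrow> bool" where
  "has_q_asymptotic_expansion q U f a \<longleftrightarrow>
     (\<forall>n K. invariant_strict_subset q U K \<longrightarrow>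
        bounded ((\<lambda>z. inverse (z ^ n) * (f z - (\<Sum>p<n. fps_nth a p * z ^ p))) ` K))"

text \<open>Functions on \<^term>\<open>U\<close> are represented by total functions; membership only
  depends on the values on \<^term>\<open>U\<close>.\<close>

definition q_asymptotic_functions :: "complex \<Rightarrow> complex set \<Rightarrow> (complex \<Rightarrow> complex) set" where
  "q_asymptotic_functions q U =
     {f. f holomorphic_on U \<and> (\<exists>a. has_q_asymptotic_expansion q U f a)}"

text \<open>Differentiability and Frechet derivatives below are over the reals, also for
  functions on \<^typ>\<open>complex\<close>, which is thereby identified with the real plane.\<close>

fun Ck_on :: "nat \<Rightarrow> 'a::real_normed_vector set \<Rightarrow> ('a \<Rightarrow> 'b::real_normed_vector) \<Rightarrow> bool" where
  "Ck_on 0 V g \<longleftrightarrow> continuous_on V g"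
| "Ck_on (Suc n) V g \<longleftrightarrow>
     (\<forall>x\<in>V. g differentiable (at x)) \<and> (\<forall>v. Ck_on n V (\<lambda>x. frechet_derivative g (at x) v))"

definition smooth_on :: "'a::real_normed_vector set \<Rightarrow> ('a \<Rightarrow> 'b::real_normed_vector) \<Rightarrow> bool" where
  "smooth_on V g \<longleftrightarrow> (\<forall>n. Ck_on n V g)"

definition partial_x :: "(complex \<Rightarrow> complex) \<Rightarrow> complex \<Rightarrow> complex" where
  "partial_x g = (\<lambda>z. frechet_derivative g (at z) 1)"

definition partial_y :: "(complex \<Rightarrow> complex) \<Rightarrow> complex \<Rightarrow> complex" where
  "partial_y g = (\<lambda>z. frechet_derivative g (at z) \<i>)"

definition partial_deriv :: "nat \<times> nat \<Rightarrow> (complex \<Rightarrow> complex) \<Rightarrow> complex \<Rightarrow> complex" where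
  "partial_deriv k g = (partial_x ^^ fst k) ((partial_y ^^ snd k) g)"

text \<open>A jet on \<^term>\<open>L\<close> is a family, indexed by pairs of naturals, of functions on
  \<^term>\<open>L\<close>. Its members are extended by zero outside \<^term>\<open>L\<close>, so that equality of jets
  is equality on \<^term>\<open>L\<close> and the zero jet is the constant zero family.\<close>

type_synonym jet = "nat \<times> nat \<Rightarrow> complex \<Rightarrow> complex"

definition whitney_smooth :: "complex set \<Rightarrow> jet set" where
  "whitney_smooth L =
     {F. \<exists>V g. open V \<and> L \<subseteq> V \<and> smooth_on V g \<and>
           F = (\<lambda>k z. if z \<in> L then partial_deriv k g z else 0)}"

text \<open>The operator \<open>1/2 (\<partial>/\<partial>x + \<i> \<partial>/\<partial>y)\<close> acting on jets by shifting the indices.\<close>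

definition dbar_jet :: "jet \<Rightarrow> jet" where
  "dbar_jet F = (\<lambda>(k1, k2) z. (F (Suc k1, k2) z + \<i> * F (k1, Suc k2) z) / 2)"

definition ker_dbar :: "complex set \<Rightarrow> jet set" where
  "ker_dbar L = {F \<in> whitney_smooth L. dbar_jet F = (\<lambda>k z. 0)}"

end

theory Submission imports Defs begin

text \<open>
  From jets to expansions: a function \<open>g\<close> that is smooth near \<open>K \<union> {0}\<close> and whose \<open>\<partial>/\<partial>\<bar>z\<close>-jet
  vanishes at \<open>0\<close> has a Taylor expansion there in powers of \<open>z\<close> alone, and the coefficients do not
  depend on \<open>K\<close> because two invariant strict subsets have a common invariant strict superset.

  From expansions to jets, Whitney's extension theorem is bypassed by writing down an extension.
  Let \<open>h\<close> be a Borel sum of the expansion, smooth on the plane, and let \<open>\<psi>\<close> be a cutoff equal to \<open>1\<close> near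
  \<open>K\<close> and supported in an invariant strict subset. As \<open>\<psi>\<close> is \<open>q\<close>-invariant near \<open>0\<close>, its derivatives
  of order \<open>j\<close> are \<open>O(\<bar>z\<bar>\<^sup>-\<^sup>j)\<close>; by Cauchy's estimates those of \<open>f - h\<close> are \<open>O(\<bar>z\<bar>\<^sup>N)\<close> for all \<open>N\<close> on
  the support. Hence \<open>g = h + \<psi> (f - h)\<close> is smooth, equals \<open>f\<close> near \<open>K\<close>, and has the jet of the formal
  series at \<open>0\<close>.
\<close>

section \<open>Functions of class \<open>C\<^sup>k\<close> and smooth bumps\<close>

text \<open>\<open>U\<close> may approach 0 only along spirals or a sequence of small discs, so
  \<open>f\<close> has no values on most of a neighbourhood of 0, whereas a jet on
  \<open>K \<union> {0}\<close> comes from a function defined on all of one. A cutoff adapted to the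
  orbits is singular at 0 and may only multiply something flat to infinite order there; this is why
  the expansion is realised by a smooth \<open>h\<close> and subtracted before cutting off. The
  bookkeeping uses a single integer: in \<open>symbol_bound k m\<close> each derivative lowers
  \<open>m\<close> by one, products add their exponents, and dilations preserve the constants of
  order 0. On a punctured disc, order \<open>m > k\<close> yields a C^k function with vanishing jet
  up to order \<open>k\<close> once the value 0 is put at the origin. Smoothness of \<open>g\<close>
  at 0 is therefore checked one \<open>k\<close> at a time, against the Taylor polynomial of degree
  \<open>k\<close>. Cauchy's estimates on circles of radius proportional to |z| also cost one power
  of |z|, but they need decay on a larger invariant set. Decay is hence always assumed for all
  compact subsets of \<open>U\<close> at once, a hypothesis that passes to the derivative.\<close>

lemma Ck_on_mono: "Ck_on n V g \<Longrightarrow> W \<subseteq> V \<Longrightarrow> Ck_on n W g"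
  by (induction n arbitrary: g) (auto intro: continuous_on_subset)

lemma has_derivative_cong_open:
  assumes "open V" "x \<in> V" "\<And>x. x \<in> V \<Longrightarrow> f x = g x"
  shows "(f has_derivative d) (at x) \<longleftrightarrow> (g has_derivative d) (at x)"
  using has_derivative_transform_within_open[OF _ assms(1,2)] assms(3) by metis

lemma differentiable_cong_open:
  assumes "open V" "x \<in> V" "\<And>x. x \<in> V \<Longrightarrow> f x = g x"
  shows "f differentiable (at x) \<longleftrightarrow> g differentiable (at x)"
  using has_derivative_cong_open[OF assms, simplified] by (simp add: differentiable_def)

lemma frechet_derivative_cong_open:
  assumes "open V" "x \<in> V" "\<And>x. x \<in> V \<Longrightarrow> f x = g x"
  shows "frechet_derivative f (at x) = frechet_derivative g (at x)"
  using has_derivative_cong_open[OF assms, simplified] by (simp add: frechet_derivative_def)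

lemma Ck_on_cong:
  assumes "open V" "\<And>x. x \<in> V \<Longrightarrow> f x = g x" "Ck_on n V f"
  shows "Ck_on n V g"
  using assms(2,3)
proof (induction n arbitrary: f g)
  case 0
  then show ?case by (simp cong: continuous_on_cong)
next
  case (Suc n)
  show ?case
    unfolding Ck_on.simps
  proof (intro conjI ballI allI)
    fix v
    show "Ck_on n V (\<lambda>x. frechet_derivative g (at x) v)"
    proof (rule Suc.IH)
      show "frechet_derivative f (at x) v = frechet_derivative g (at x) v" if "x \<in> V" for x
        using frechet_derivative_cong_open[where f = f and g = g, OF assms(1) that Suc.prems(1)] by simp
      show "Ck_on n V (\<lambda>x. frechet_derivative f (at x) v)" using Suc.prems by simp
    qed
  next
    fix x assume "x \<in> V"
    then show "g differentiable (at x)"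
      using differentiable_cong_open[where f = f and g = g, OF assms(1) _ Suc.prems(1)] Suc.prems(2) by simp
  qed
qed

lemma Ck_on_SucD: "Ck_on (Suc n) V g \<Longrightarrow> Ck_on n V g"
proof (induction n arbitrary: g)
  case 0
  then show ?case
    by (auto intro!: continuous_at_imp_continuous_on differentiable_imp_continuous_within)
next
  case (Suc n)
  then show ?case by (metis Ck_on.simps(2))
qed

lemma Ck_on_le: "Ck_on n V g \<Longrightarrow> m \<le> n \<Longrightarrow> Ck_on m V g"
  by (induction n) (use Ck_on_SucD le_Suc_eq in blast)+

lemma Ck_on_locally:
  assumes "\<And>x. x \<in> V \<Longrightarrow> \<exists>W. open W \<and> x \<in> W \<and> Ck_on n W g"
  shows "Ck_on n V g"
  using assms
proof (induction n arbitrary: g)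
  case 0
  then show ?case
    by (force intro!: continuous_at_imp_continuous_on simp: continuous_on_eq_continuous_at)
next
  case (Suc n)
  show ?case
    unfolding Ck_on.simps
  proof (intro conjI ballI allI)
    fix v
    show "Ck_on n V (\<lambda>x. frechet_derivative g (at x) v)"
      using Suc.prems by (intro Suc.IH) (metis Ck_on.simps(2))
  qed (use Suc.prems in force)
qed

lemma Ck_on_Un:
  assumes "open V" "open W" "Ck_on n V g" "Ck_on n W g"
  shows "Ck_on n (V \<union> W) g"
  using assms by (intro Ck_on_locally) blast

text \<open>The recursion in \<open>Ck_on\<close> mentions \<open>frechet_derivative\<close>, which
  is awkward to compute with. Uniqueness of derivatives lets any explicit formula take its place;
  openness of \<open>V\<close> lets the replacement be differentiated again.\<close>

lemma Ck_on_SucI: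
  assumes "open V" "\<And>x. x \<in> V \<Longrightarrow> (g has_derivative g' x) (at x)"
    "\<And>v. Ck_on n V (\<lambda>x. g' x v)"
  shows "Ck_on (Suc n) V g"
  unfolding Ck_on.simps
proof (intro conjI ballI allI)
  fix v
  show "Ck_on n V (\<lambda>x. frechet_derivative g (at x) v)"
    using assms by (intro Ck_on_cong[OF assms(1) _ assms(3)[of v]]) (metis frechet_derivative_at)
qed (use assms differentiable_def in blast)

lemma Ck_on_SucE:
  assumes "Ck_on (Suc n) V g" "x \<in> V"
  shows "(g has_derivative frechet_derivative g (at x)) (at x)"
  using assms frechet_derivative_works by auto

lemma Ck_on_const [simp]: "Ck_on n V (\<lambda>x. c)"
  by (induction n arbitrary: c) auto

lemma Ck_on_bounded_linear:
  assumes "bounded_linear T" "open V"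
  shows "Ck_on n V T"
proof (cases n)
  case 0
  then show ?thesis using assms by (simp add: linear_continuous_on)
next
  case (Suc m)
  show ?thesis unfolding Suc
    by (rule Ck_on_SucI[where g' = "\<lambda>_. T"])
       (use assms bounded_linear_imp_has_derivative in auto)
qed

lemma Ck_on_bounded_linear_compose:
  assumes "bounded_linear T" "open V" "Ck_on n V g"
  shows "Ck_on n V (\<lambda>x. T (g x))"
  using assms(3)
proof (induction n arbitrary: g)
  case 0
  then show ?case using assms by (simp add: bounded_linear.continuous_on)
next
  case (Suc n)
  show ?case
  proof (rule Ck_on_SucI[OF assms(2)])
    fix x assume "x \<in> V"
    then show "((\<lambda>x. T (g x)) has_derivative (\<lambda>v. T (frechet_derivative g (at x) v))) (at x)"
      using Ck_on_SucE[OF Suc.prems] assms(1) bounded_linear.has_derivative by blast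
  qed (use Suc in simp)
qed

lemma Ck_on_add:
  assumes "open V" "Ck_on n V f" "Ck_on n V g"
  shows "Ck_on n V (\<lambda>x. f x + g x)"
  using assms(2,3)
proof (induction n arbitrary: f g)
  case 0
  then show ?case by (auto intro: continuous_on_add)
next
  case (Suc n)
  show ?case
    by (rule Ck_on_SucI[OF assms(1), where
          g' = "\<lambda>x v. frechet_derivative f (at x) v + frechet_derivative g (at x) v"])
       (use Suc in \<open>auto intro!: has_derivative_add Ck_on_SucE\<close>)
qed

lemma Ck_on_mult:
  fixes f g :: "'a::real_normed_vector \<Rightarrow> 'b::real_normed_algebra"
  assumes "open V" "Ck_on n V f" "Ck_on n V g"
  shows "Ck_on n V (\<lambda>x. f x * g x)"
  using assms(2,3)
proof (induction n arbitrary: f g)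
  case 0
  then show ?case by (auto intro: continuous_on_mult)
next
  case (Suc n)
  show ?case
  proof (rule Ck_on_SucI[OF assms(1), where
          g' = "\<lambda>x v. f x * frechet_derivative g (at x) v + frechet_derivative f (at x) v * g x"])
    show "Ck_on n V (\<lambda>x. f x * frechet_derivative g (at x) v + frechet_derivative f (at x) v * g x)" for v
      using Suc.prems by (intro Ck_on_add[OF assms(1)] Suc.IH) (auto dest: Ck_on_SucD simp del: Ck_on.simps, auto)
  qed (use Suc.prems in \<open>auto intro!: has_derivative_mult Ck_on_SucE\<close>)
qed

lemma Ck_on_diff:
  assumes "open V" "Ck_on n V f" "Ck_on n V g"
  shows "Ck_on n V (\<lambda>x. f x - g x)"
  using Ck_on_add[OF assms(1,2) Ck_on_bounded_linear_compose[OF bounded_linear_minus[OF bounded_linear_ident] assms(1,3)]]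
  by simp

lemma Ck_on_prod:
  fixes f :: "'i \<Rightarrow> 'a::real_normed_vector \<Rightarrow> 'b::{real_normed_algebra_1,comm_ring_1}"
  assumes "open V" "\<And>i. i \<in> I \<Longrightarrow> Ck_on n V (f i)"
  shows "Ck_on n V (\<lambda>x. \<Prod>i\<in>I. f i x)"
  using assms(2) by (induction I rule: infinite_finite_induct) (auto intro: Ck_on_mult[OF assms(1)])

lemma Ck_on_sum:
  assumes "open V" "\<And>i. i \<in> I \<Longrightarrow> Ck_on n V (f i)"
  shows "Ck_on n V (\<lambda>x. \<Sum>i\<in>I. f i x)"
  using assms(2) by (induction I rule: infinite_finite_induct) (auto intro: Ck_on_add[OF assms(1)])

lemma Ck_on_affine:
  fixes g :: "complex \<Rightarrow> 'b::real_normed_vector"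
  assumes "Ck_on n V g" "open W" "\<And>z. z \<in> W \<Longrightarrow> c * z + d \<in> V"
  shows "Ck_on n W (\<lambda>z. g (c * z + d))"
  using assms(1)
proof (induction n arbitrary: g)
  case 0
  then have "continuous_on ((\<lambda>z. c * z + d) ` W) g"
    using assms(3) by (auto intro: continuous_on_subset)
  then have "continuous_on W (\<lambda>z. g (c * z + d))"
    by (rule continuous_on_compose2) (auto intro!: continuous_intros)
  then show ?case by simp
next
  case (Suc n)
  show ?case
  proof (rule Ck_on_SucI[OF assms(2)])
    fix x assume "x \<in> W"
    then have "(g has_derivative frechet_derivative g (at (c * x + d))) (at (c * x + d))"
      using Ck_on_SucE[OF Suc.prems] assms(3) by blast
    moreover have "((\<lambda>z. c * z + d) has_derivative (\<lambda>v. c * v)) (at x)"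
      by (auto intro!: derivative_eq_intros)
    ultimately show "((\<lambda>z. g (c * z + d)) has_derivative (\<lambda>v. frechet_derivative g (at (c * x + d)) (c * v))) (at x)"
      using has_derivative_compose by blast
  next
    show "Ck_on n W (\<lambda>x. frechet_derivative g (at (c * x + d)) (c * v))" for v
      by (rule Suc.IH[of "\<lambda>y. frechet_derivative g (at y) (c * v)"]) (use Suc.prems in simp)
  qed
qed

text \<open>The outer function comes as a whole sequence of successive derivatives, so that the
  chain rule leads from index \<open>n\<close> to \<open>Suc n\<close> and the induction on
  \<open>k\<close> closes.\<close>

lemma Ck_on_compose_real:
  fixes \<phi> :: "nat \<Rightarrow> real \<Rightarrow> real" and g :: "'a::real_normed_vector \<Rightarrow> real"
  assumes \<phi>: "\<And>n t. (\<phi> n has_real_derivative \<phi> (Suc n) t) (at t)"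
    and V: "open V" and "Ck_on k V g"
  shows "Ck_on k V (\<lambda>x. \<phi> n (g x))"
  using assms(3)
proof (induction k arbitrary: n)
  case 0
  have "continuous_on UNIV (\<phi> n)"
    using \<phi> by (meson DERIV_continuous continuous_at_imp_continuous_on)
  then show ?case using 0 by (auto intro: continuous_on_compose2)
next
  case (Suc k)
  show ?case
  proof (rule Ck_on_SucI[OF V, where g' = "\<lambda>x v. \<phi> (Suc n) (g x) * frechet_derivative g (at x) v"])
    fix x assume "x \<in> V"
    then show "((\<lambda>x. \<phi> n (g x)) has_derivative (\<lambda>v. \<phi> (Suc n) (g x) * frechet_derivative g (at x) v)) (at x)"
      using has_derivative_compose[OF Ck_on_SucE[OF Suc.prems], of x "\<phi> n"] \<phi>[of n "g x"]
      by (simp add: has_field_derivative_def)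
  next
    show "Ck_on k V (\<lambda>x. \<phi> (Suc n) (g x) * frechet_derivative g (at x) v)" for v
      using Suc.prems by (intro Ck_on_mult[OF V] Suc.IH) (auto dest: Ck_on_SucD simp del: Ck_on.simps, auto)
  qed
qed

section \<open>A flat exponential and a smooth bump\<close>

lemma poly_times_exp_minus_tendsto_0:
  "((\<lambda>s. poly p s * exp (- s)) \<longlongrightarrow> (0::real)) at_top"
proof -
  \<comment> \<open>The factor \<open>s ^ k\<close> strengthens the induction:
    \<open>pCons a p\<close> stands for a + s p(s), so each step moves one more factor s in
    front.\<close>
  have "((\<lambda>s. s ^ k * (poly p s * exp (- s))) \<longlongrightarrow> (0::real)) at_top" for k
  proof (induction p arbitrary: k)
    case 0
    then show ?case by simp
  next
    case (pCons a p)
    have "((\<lambda>s. a * (s ^ k / exp s) + s ^ Suc k * (poly p s * exp (- s))) \<longlongrightarrow> a * 0 + 0) at_top"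
      by (intro tendsto_intros tendsto_power_div_exp_0 pCons.IH)
    then show ?case by (simp add: algebra_simps exp_minus divide_inverse)
  qed
  from this[of 0] show ?thesis by simp
qed

text \<open>With s = 1/t one has ds/dt = -s^2, so the t-derivative of P(s) exp(-s) is s^2 (P(s) -
  P'(s)) exp(-s).\<close>

primrec flat_exp_poly :: "nat \<Rightarrow> real poly" where
  "flat_exp_poly 0 = 1"
| "flat_exp_poly (Suc n) = [:0, 0, 1:] * (flat_exp_poly n - pderiv (flat_exp_poly n))"

text \<open>The \<open>n\<close>-th derivative of the function equal to \<open>exp (-1/t)\<close> for \<open>t > 0\<close> and to \<open>0\<close> elsewhere.\<close>

definition flat_exp :: "nat \<Rightarrow> real \<Rightarrow> real" where
  "flat_exp n t = (if t > 0 then poly (flat_exp_poly n) (inverse t) * exp (- inverse t) else 0)"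

lemma flat_exp_deriv: "(flat_exp n has_real_derivative flat_exp (Suc n) t) (at t)"
proof -
  consider "t > 0" | "t < 0" | "t = 0" by linarith
  then show ?thesis
  proof cases
    case 1
    have "((\<lambda>t. poly (flat_exp_poly n) (inverse t) * exp (- inverse t)) has_real_derivative flat_exp (Suc n) t) (at t)"
      using 1 by (auto intro!: derivative_eq_intros poly_DERIV[THEN DERIV_chain2]
          simp: flat_exp_def power2_eq_square algebra_simps)
    then show ?thesis
      by (rule has_field_derivative_transform_within_open[of _ _ _ "{0<..}"]) (use 1 in \<open>auto simp: flat_exp_def\<close>)
  next
    case 2
    have "((\<lambda>t. 0) has_real_derivative flat_exp (Suc n) t) (at t)"
      using 2 by (simp add: flat_exp_def)
    then show ?thesis
      by (rule has_field_derivative_transform_within_open[of _ _ _ "{..<0}"]) (use 2 in \<open>auto simp: flat_exp_def\<close>)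
  next
    case 3
    \<comment> \<open>The factor \<open>[:0,1:]\<close> is the 1/h of the difference quotient at 0,
      written in the variable 1/h.\<close>
    have "((\<lambda>h. poly ([:0,1:] * flat_exp_poly n) (inverse h) * exp (- inverse h)) \<longlongrightarrow> 0) (at_right 0)"
      by (rule filterlim_compose[OF poly_times_exp_minus_tendsto_0 filterlim_inverse_at_top_right])
    then have "((\<lambda>h. flat_exp n h / h) \<longlongrightarrow> 0) (at_right 0)"
      by (rule Lim_transform_eventually)
         (auto simp: eventually_at_filter flat_exp_def divide_inverse intro!: always_eventually)
    moreover have "((\<lambda>h. flat_exp n h / h) \<longlongrightarrow> 0) (at_left 0)"
      by (rule Lim_transform_eventually[OF tendsto_const])
         (auto simp: eventually_at_filter flat_exp_def intro!: always_eventually)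
    ultimately have "((\<lambda>h. flat_exp n h / h) \<longlongrightarrow> 0) (at 0)"
      by (simp add: filterlim_at_split)
    then show ?thesis
      using 3 by (simp add: DERIV_def flat_exp_def)
  qed
qed

lemma Ck_on_flat_exp:
  assumes "open V" "Ck_on k V g"
  shows "Ck_on k V (\<lambda>x. flat_exp n (g x))"
  by (rule Ck_on_compose_real[where \<phi> = flat_exp, OF flat_exp_deriv assms])

lemma flat_exp_0_pos: "t > 0 \<Longrightarrow> flat_exp 0 t > 0"
  and flat_exp_0_le: "s \<le> t \<Longrightarrow> flat_exp 0 s \<le> flat_exp 0 t"
  by (auto simp: flat_exp_def)

lemma ex_smooth_bump:
  obtains b :: "complex \<Rightarrow> complex" where "\<And>k. Ck_on k UNIV b"
    "\<And>z. (norm z)\<^sup>2 \<le> 1 / 2 \<Longrightarrow> b z = 1" "\<And>z. norm z \<ge> 1 \<Longrightarrow> b z = 0"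
proof -
  define e where "e = flat_exp 0"
  \<comment> \<open>For t at most 1/2 the inner \<open>e\<close> vanishes and the quotient is 1; for
    t at least 1 the outer argument is nonpositive and the quotient is 0. Nesting two copies of
    \<open>e\<close> leaves only a constant denominator. The argument t will be the squared norm,
    which is a polynomial in the coordinates.\<close>
  define s where "s t = e (e 1 - e (2 * t - 1)) / e (e 1)" for t
  define b where "b z = complex_of_real (s (Re z * Re z + Im z * Im z))" for z
  have nz: "(norm z)\<^sup>2 = Re z * Re z + Im z * Im z" for z
    unfolding cmod_power2 by (simp add: power2_eq_square)
  have [simp]: "e 1 > 0" "e (e 1) > 0" unfolding e_def by (intro flat_exp_0_pos zero_less_one)+
  then have [simp]: "e (e 1) \<noteq> 0" by linarith
  have e0: "e t = 0" if "t \<le> 0" for t using that by (simp add: e_def flat_exp_def)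
  show thesis
  proof
    fix k
    have Re: "Ck_on k UNIV Re" and Im: "Ck_on k UNIV Im"
      by (auto intro: Ck_on_bounded_linear bounded_linear_Re bounded_linear_Im)
    have "Ck_on k UNIV (\<lambda>z. 2 * (Re z * Re z + Im z * Im z) - 1)"
      by (rule Ck_on_diff[OF open_UNIV Ck_on_mult[OF open_UNIV Ck_on_const Ck_on_add[OF open_UNIV Ck_on_mult[OF open_UNIV Re Re] Ck_on_mult[OF open_UNIV Im Im]]] Ck_on_const])
    then have "Ck_on k UNIV (\<lambda>z. e (2 * (Re z * Re z + Im z * Im z) - 1))"
      unfolding e_def by (rule Ck_on_flat_exp[OF open_UNIV])
    then have "Ck_on k UNIV (\<lambda>z. e 1 - e (2 * (Re z * Re z + Im z * Im z) - 1))"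
      by (rule Ck_on_diff[OF open_UNIV Ck_on_const])
    then have "Ck_on k UNIV (\<lambda>z. e (e 1 - e (2 * (Re z * Re z + Im z * Im z) - 1)))"
      unfolding e_def by (rule Ck_on_flat_exp[OF open_UNIV])
    then have "Ck_on k UNIV (\<lambda>z. e (e 1 - e (2 * (Re z * Re z + Im z * Im z) - 1)) * inverse (e (e 1)))"
      by (intro Ck_on_mult) auto
    then show "Ck_on k UNIV b"
      unfolding b_def s_def divide_inverse
      by (rule Ck_on_bounded_linear_compose[OF bounded_linear_of_real open_UNIV])
  next
    fix z :: complex assume "(norm z)\<^sup>2 \<le> 1 / 2"
    then show "b z = 1" unfolding b_def s_def nz by (simp add: e0)
  next
    fix z :: complex assume "norm z \<ge> 1"
    then have "(norm z)\<^sup>2 \<ge> 1" by simp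
    then have "e 1 \<le> e (2 * (Re z * Re z + Im z * Im z) - 1)"
      unfolding nz e_def by (intro flat_exp_0_le) simp
    then show "b z = 0" unfolding b_def s_def by (simp add: e0)
  qed
qed

section \<open>Symbol estimates at the origin\<close>

text \<open>All iterated derivatives of order \<open>j \<le> k\<close> of \<open>g\<close>, in directions \<open>v\<^sub>1, \<dots>, v\<^sub>j\<close>, are bounded on \<open>W\<close> by
  \<open>C \<bar>v\<^sub>1\<bar> \<cdots> \<bar>v\<^sub>j\<bar> \<bar>z\<bar>\<^sup>m\<^sup>-\<^sup>j\<close>. The derivatives at a point of \<open>W\<close> are taken in the whole plane, so \<open>W\<close>
  need not be open.\<close>

primrec symbol_bound :: "nat \<Rightarrow> int \<Rightarrow> real \<Rightarrow> complex set \<Rightarrow> (complex \<Rightarrow> complex) \<Rightarrow> bool" where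
  "symbol_bound 0 m C W g \<longleftrightarrow> (\<forall>z\<in>W. isCont g z \<and> norm (g z) \<le> C * norm z powi m)"
| "symbol_bound (Suc k) m C W g \<longleftrightarrow>
     (\<forall>z\<in>W. g differentiable (at z) \<and> norm (g z) \<le> C * norm z powi m) \<and>
     (\<forall>v. symbol_bound k (m - 1) (C * norm v) W (\<lambda>z. frechet_derivative g (at z) v))"

lemma symbol_bound_norm: "symbol_bound k m C W g \<Longrightarrow> z \<in> W \<Longrightarrow> norm (g z) \<le> C * norm z powi m"
  by (cases k) auto

lemma symbol_bound_subset: "symbol_bound k m C W g \<Longrightarrow> V \<subseteq> W \<Longrightarrow> symbol_bound k m C V g"
  by (induction k arbitrary: m C g) auto

text \<open>Every clause of \<open>symbol_bound\<close> is pointwise, so the set may vary with the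
  point as long as the constant does not. Sums and products that are finite only locally near each
  nonzero point are estimated in this way.\<close>

lemma symbol_bound_Union:
  "(\<And>z. z \<in> V \<Longrightarrow> \<exists>W. z \<in> W \<and> symbol_bound k m C W g) \<Longrightarrow> symbol_bound k m C V g"
proof (induction k arbitrary: m C g)
  case (Suc k)
  show ?case
    unfolding symbol_bound.simps
  proof (intro conjI ballI allI)
    fix v
    show "symbol_bound k (m - 1) (C * norm v) V (\<lambda>z. frechet_derivative g (at z) v)"
      using Suc.prems by (intro Suc.IH) (metis symbol_bound.simps(2))
  qed (use Suc.prems in force)+
qed force

lemma symbol_bound_Un:
  "symbol_bound k m C V g \<Longrightarrow> symbol_bound k m C W g \<Longrightarrow> symbol_bound k m C (V \<union> W) g"
  by (induction k arbitrary: m C g) auto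

lemma symbol_bound_SucD:
  "symbol_bound (Suc k) m C W g \<Longrightarrow> symbol_bound k m C W g"
proof (induction k arbitrary: m C g)
  case 0
  then show ?case by (auto intro: differentiable_imp_continuous_within)
next
  case (Suc k)
  then show ?case by (metis symbol_bound.simps(2))
qed

lemma symbol_bound_le: "symbol_bound n m C W g \<Longrightarrow> k \<le> n \<Longrightarrow> symbol_bound k m C W g"
  by (induction n) (use symbol_bound_SucD le_Suc_eq in blast)+

lemma symbol_bound_weaken:
  assumes "symbol_bound k m C W g"
    and "\<And>z j. z \<in> W \<Longrightarrow> j \<le> k \<Longrightarrow> C * norm z powi (m - int j) \<le> D * norm z powi (n - int j)"
  shows "symbol_bound k n D W g"
  using assms
proof (induction k arbitrary: m n C D g)
  case 0
  then show ?case by fastforce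
next
  case (Suc k)
  show ?case
    unfolding symbol_bound.simps
  proof (intro conjI ballI allI)
    fix z assume "z \<in> W"
    then show "norm (g z) \<le> D * norm z powi n"
      using Suc.prems(1) Suc.prems(2)[of z 0] by fastforce
  next
    fix v
    show "symbol_bound k (n - 1) (D * norm v) W (\<lambda>z. frechet_derivative g (at z) v)"
    proof (rule Suc.IH)
      show "symbol_bound k (m - 1) (C * norm v) W (\<lambda>z. frechet_derivative g (at z) v)"
        using Suc.prems(1) by simp
      fix z j assume "z \<in> W" "j \<le> k"
      then show "C * norm v * norm z powi (m - 1 - int j) \<le> D * norm v * norm z powi (n - 1 - int j)"
        using mult_right_mono[OF Suc.prems(2)[of z "Suc j"], of "norm v"] by (simp add: algebra_simps)
    qed
  qed (use Suc.prems in auto)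
qed

lemma symbol_bound_mono: "symbol_bound k m C W g \<Longrightarrow> C \<le> D \<Longrightarrow> symbol_bound k m D W g"
  by (erule symbol_bound_weaken) (auto intro: mult_right_mono)

lemma symbol_bound_cong:
  assumes "open V" "W \<subseteq> V" "\<And>x. x \<in> V \<Longrightarrow> f x = g x" "symbol_bound k m C W f"
  shows "symbol_bound k m C W g"
  using assms(3,4)
proof (induction k arbitrary: m C f g)
  case 0
  show ?case
    unfolding symbol_bound.simps
  proof (intro ballI conjI)
    fix z assume z: "z \<in> W"
    then have "eventually (\<lambda>x. f x = g x) (nhds z)"
      unfolding eventually_nhds using assms(1,2) 0(1) by (intro exI[of _ V]) auto
    from isCont_cong[OF this] show "isCont g z" using 0 z by simp
    have "f z = g z" using z assms(2) 0(1) by blast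
    with 0 z show "norm (g z) \<le> C * norm z powi m" by fastforce
  qed
next
  case (Suc k)
  show ?case
    unfolding symbol_bound.simps
  proof (intro conjI ballI allI)
    fix v
    show "symbol_bound k (m - 1) (C * norm v) W (\<lambda>z. frechet_derivative g (at z) v)"
    proof (rule Suc.IH)
      show "frechet_derivative f (at x) v = frechet_derivative g (at x) v" if "x \<in> V" for x
        using frechet_derivative_cong_open[where f = f and g = g, OF assms(1) that Suc.prems(1)] by simp
    qed (use Suc.prems in simp)
    fix z assume z: "z \<in> W"
    then have "f z = g z" using assms(2) Suc.prems(1) by blast
    with symbol_bound_norm[OF Suc.prems(2) z] show "norm (g z) \<le> C * norm z powi m" by simp
    show "g differentiable (at z)"
      using differentiable_cong_open[where f = f and g = g, OF assms(1) subsetD[OF assms(2) z] Suc.prems(1)] Suc.prems(2) z by simp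
  qed
qed

lemma symbol_bound_SucI:
  assumes "open V" "W \<subseteq> V" "\<And>x. x \<in> V \<Longrightarrow> (g has_derivative g' x) (at x)"
    "\<And>x. x \<in> W \<Longrightarrow> norm (g x) \<le> C * norm x powi m"
    "\<And>v. symbol_bound k (m - 1) (C * norm v) W (\<lambda>x. g' x v)"
  shows "symbol_bound (Suc k) m C W g"
  unfolding symbol_bound.simps
proof (intro conjI ballI allI)
  fix v
  show "symbol_bound k (m - 1) (C * norm v) W (\<lambda>z. frechet_derivative g (at z) v)"
    by (rule symbol_bound_cong[OF assms(1,2) _ assms(5)]) (metis assms(3) frechet_derivative_at)
qed (use assms in \<open>auto simp: differentiable_def\<close>)

lemma symbol_bound_SucE:
  assumes "symbol_bound (Suc k) m C W g" "x \<in> W"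
  shows "(g has_derivative frechet_derivative g (at x)) (at x)"
  using assms frechet_derivative_works by auto

lemma symbol_bound_0: "0 \<le> C \<Longrightarrow> symbol_bound k m C W (\<lambda>_. 0)"
  by (induction k arbitrary: m C) auto

lemma symbol_bound_const: "symbol_bound k 0 (norm c) W (\<lambda>_. c)"
  by (cases k) (auto intro: symbol_bound_0)

lemma symbol_bound_ident: "symbol_bound k 1 1 W (\<lambda>z. z)"
  using symbol_bound_const by (cases k) auto

lemma symbol_bound_add:
  assumes "open W" "symbol_bound k m C W f" "symbol_bound k m D W g"
  shows "symbol_bound k m (C + D) W (\<lambda>z. f z + g z)"
  using assms(2,3)
proof (induction k arbitrary: m C D f g)
  case 0
  then show ?case by (auto simp: distrib_right intro: norm_triangle_mono)
next
  case (Suc k)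
  show ?case
  proof (rule symbol_bound_SucI[OF assms(1) order.refl, where
        g' = "\<lambda>x v. frechet_derivative f (at x) v + frechet_derivative g (at x) v"])
    show "symbol_bound k (m - 1) ((C + D) * norm v) W
           (\<lambda>x. frechet_derivative f (at x) v + frechet_derivative g (at x) v)" for v
      using Suc.IH[of "m - 1" "C * norm v" "\<lambda>x. frechet_derivative f (at x) v"
          "D * norm v" "\<lambda>x. frechet_derivative g (at x) v"] Suc.prems
      by (simp add: algebra_simps)
    show "norm (f x + g x) \<le> (C + D) * norm x powi m" if "x \<in> W" for x
      using norm_triangle_mono[OF symbol_bound_norm[OF Suc.prems(1) that] symbol_bound_norm[OF Suc.prems(2) that]]
      by (simp add: distrib_right)
  qed (use Suc.prems in \<open>auto intro!: has_derivative_add symbol_bound_SucE\<close>)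
qed

text \<open>Each differentiation splits a product in two by Leibniz's rule, whence
  \<open>2 ^ k\<close>. Away from 0, \<open>powi\<close> turns sums of integer exponents into
  products.\<close>

lemma symbol_bound_mult:
  assumes "open W" "0 \<notin> W" "symbol_bound k m C W f" "symbol_bound k n D W g" "0 \<le> C" "0 \<le> D"
  shows "symbol_bound k (m + n) (2 ^ k * C * D) W (\<lambda>z. f z * g z)"
  using assms(3-6)
proof (induction k arbitrary: m n C D f g)
  case 0
  have "norm (f z * g z) \<le> C * D * norm z powi (m + n)" if "z \<in> W" for z
  proof -
    have "norm (f z) * norm (g z) \<le> (C * norm z powi m) * (D * norm z powi n)"
      using 0 that by (intro mult_mono) auto
    moreover have "z \<noteq> 0" using that assms(2) by auto
    ultimately show ?thesis by (simp add: norm_mult power_int_add algebra_simps)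
  qed
  then show ?case using 0 by auto
next
  case (Suc k)
  show ?case
  proof (rule symbol_bound_SucI[OF assms(1) order.refl, where
          g' = "\<lambda>x v. f x * frechet_derivative g (at x) v + frechet_derivative f (at x) v * g x"])
    fix v
    have f: "symbol_bound k m C W f" and g: "symbol_bound k n D W g"
      using Suc.prems symbol_bound_SucD by blast+
    have f': "symbol_bound k (m - 1) (C * norm v) W (\<lambda>x. frechet_derivative f (at x) v)"
      and g': "symbol_bound k (n - 1) (D * norm v) W (\<lambda>x. frechet_derivative g (at x) v)"
      using Suc.prems by auto
    have "symbol_bound k (m + n - 1) (2 ^ k * C * (D * norm v) + 2 ^ k * (C * norm v) * D) W
       (\<lambda>x. f x * frechet_derivative g (at x) v + frechet_derivative f (at x) v * g x)"
      using Suc.IH[OF f g'] Suc.IH[OF f' g] Suc.prems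
      by (intro symbol_bound_add assms(1)) (simp_all add: algebra_simps)
    then show "symbol_bound k (m + n - 1) (2 ^ Suc k * C * D * norm v) W
       (\<lambda>x. f x * frechet_derivative g (at x) v + frechet_derivative f (at x) v * g x)"
      by (simp add: algebra_simps)
  next
    fix z assume z: "z \<in> W"
    then have nz: "z \<noteq> 0" using assms(2) by auto
    have "norm (f z) * norm (g z) \<le> (C * norm z powi m) * (D * norm z powi n)"
      using Suc.prems(3) symbol_bound_norm[OF Suc.prems(1) z] symbol_bound_norm[OF Suc.prems(2) z]
      by (intro mult_mono) auto
    also have "\<dots> = 1 * (C * D * norm z powi (m + n))"
      using nz by (simp add: power_int_add algebra_simps)
    also have "\<dots> \<le> 2 ^ Suc k * (C * D * norm z powi (m + n))"
      using Suc.prems by (intro mult_right_mono one_le_power) auto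
    finally show "norm (f z * g z) \<le> 2 ^ Suc k * C * D * norm z powi (m + n)"
      by (simp add: norm_mult algebra_simps)
  qed (use Suc.prems in \<open>auto intro!: has_derivative_mult symbol_bound_SucE\<close>)
qed

lemma symbol_bound_sum:
  assumes "open W" "\<And>i. i \<in> I \<Longrightarrow> symbol_bound k m (C i) W (f i)"
  shows "symbol_bound k m (\<Sum>i\<in>I. C i) W (\<lambda>z. \<Sum>i\<in>I. f i z)"
  using assms(2)
  by (induction I rule: infinite_finite_induct) (auto intro: symbol_bound_add[OF assms(1)] symbol_bound_0)

text \<open>For \<open>m = 0\<close> the constant is unchanged. This dilation invariance makes the
  estimates of b(z/\<epsilon>) independent of \<epsilon>, and carries an estimate on one annulus
  along a whole orbit towards 0.\<close>

lemma symbol_bound_scale: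
  assumes "open W" "symbol_bound k m C W g" "c \<noteq> 0"
  shows "symbol_bound k m (C * norm c powi m) {z. c * z \<in> W} (\<lambda>z. g (c * z))"
  using assms(2)
proof (induction k arbitrary: m C g)
  case 0
  show ?case
    unfolding symbol_bound.simps
  proof (intro ballI conjI)
    fix z assume "z \<in> {z. c * z \<in> W}"
    then have "isCont g (c * z)" "norm (g (c * z)) \<le> C * norm (c * z) powi m" using 0 by auto
    then show "isCont (\<lambda>z. g (c * z)) z"
      by (intro continuous_at_compose[of z "\<lambda>z. c * z" g, unfolded o_def] continuous_intros)
    show "norm (g (c * z)) \<le> C * norm c powi m * norm z powi m"
      using \<open>norm (g (c * z)) \<le> _\<close> by (simp add: norm_mult power_int_mult_distrib algebra_simps)
  qed
next
  case (Suc k)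
  have der: "((\<lambda>z. g (c * z)) has_derivative (\<lambda>v. frechet_derivative g (at (c * z)) (c * v))) (at z)"
    if "g differentiable (at (c * z))" for z
  proof (rule has_derivative_compose[of "\<lambda>z. c * z" "\<lambda>v. c * v"])
    show "((\<lambda>z. c * z) has_derivative (\<lambda>v. c * v)) (at z)"
      by (auto intro!: derivative_eq_intros)
  qed (use that frechet_derivative_works in blast)
  have "open {z. c * z \<in> W}"
    using assms(1) by (intro open_vimage[of W "\<lambda>z. c * z", unfolded vimage_def] continuous_intros)
  then show ?case
  proof (rule symbol_bound_SucI[OF _ order.refl])
    fix v
    have "symbol_bound k (m - 1) (C * norm (c * v) * norm c powi (m - 1)) {z. c * z \<in> W}
        (\<lambda>z. frechet_derivative g (at (c * z)) (c * v))"
      using Suc.prems by (intro Suc.IH[where g = "\<lambda>w. frechet_derivative g (at w) (c * v)"]) simp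
    moreover have "norm c powi m = norm c * norm c powi (m - 1)"
      using assms(3) by (simp add: power_int_diff)
    then have "C * norm (c * v) * norm c powi (m - 1) = C * norm c powi m * norm v"
      by (simp add: norm_mult)
    ultimately show "symbol_bound k (m - 1) (C * norm c powi m * norm v) {z. c * z \<in> W}
       (\<lambda>z. frechet_derivative g (at (c * z)) (c * v))"
      by simp
  next
    fix z assume "z \<in> {z. c * z \<in> W}"
    then have "norm (g (c * z)) \<le> C * norm (c * z) powi m" using Suc.prems by auto
    then show "norm (g (c * z)) \<le> C * norm c powi m * norm z powi m"
      by (simp add: norm_mult power_int_mult_distrib algebra_simps)
  qed (use Suc.prems der in auto)
qed

lemma symbol_bound_cmult:
  assumes "open W" "symbol_bound k m C W f"
  shows "symbol_bound k m (C * norm c) W (\<lambda>z. c * f z)"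
  using assms(2)
proof (induction k arbitrary: m C f)
  case 0
  have "norm (c * f z) \<le> C * norm c * norm z powi m" if "z \<in> W" for z
    using mult_left_mono[OF symbol_bound_norm[OF 0 that], of "norm c"]
    by (simp add: norm_mult algebra_simps)
  then show ?case using 0 by auto
next
  case (Suc k)
  show ?case
  proof (rule symbol_bound_SucI[OF assms(1) order.refl, where g' = "\<lambda>x v. c * frechet_derivative f (at x) v"])
    show "symbol_bound k (m - 1) (C * norm c * norm v) W (\<lambda>x. c * frechet_derivative f (at x) v)" for v
      using Suc.IH[of "m - 1" "C * norm v" "\<lambda>x. frechet_derivative f (at x) v"] Suc.prems
      by (simp add: algebra_simps)
    show "norm (c * f x) \<le> C * norm c * norm x powi m" if "x \<in> W" for x
      using mult_left_mono[OF symbol_bound_norm[OF Suc.prems that], of "norm c"]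
      by (simp add: norm_mult algebra_simps)
    show "((\<lambda>x. c * f x) has_derivative (\<lambda>v. c * frechet_derivative f (at x) v)) (at x)" if "x \<in> W" for x
      using symbol_bound_SucE[OF Suc.prems that] by (rule has_derivative_mult_right)
  qed
qed

lemma frechet_derivative_complex_eq:
  assumes "g differentiable (at z)"
  shows "frechet_derivative g (at z) v =
    of_real (Re v) * frechet_derivative g (at z) 1 + of_real (Im v) * frechet_derivative g (at z) \<i>"
proof -
  interpret linear "frechet_derivative g (at z)" using assms by (rule linear_frechet_derivative)
  have "v = Re v *\<^sub>R 1 + Im v *\<^sub>R \<i>" by (simp add: complex_eq_iff)
  then have "frechet_derivative g (at z) v = frechet_derivative g (at z) (Re v *\<^sub>R 1 + Im v *\<^sub>R \<i>)" by simp
  also have "\<dots> = Re v *\<^sub>R frechet_derivative g (at z) 1 + Im v *\<^sub>R frechet_derivative g (at z) \<i>"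
    by (simp only: add scale)
  finally show ?thesis by (simp add: scaleR_conv_of_real)
qed

text \<open>On a compact set avoiding 0, |z|^m is bounded below by a positive number, so continuity
  of the derivatives gives bounds of every order \<open>m\<close>.\<close>

lemma Ck_on_imp_symbol_bound:
  assumes "open V" "compact A" "A \<subseteq> V" "0 \<notin> A" "open W" "W \<subseteq> A" "Ck_on k V g"
  shows "\<exists>C. 0 \<le> C \<and> symbol_bound k m C W g"
  using assms(7)
proof (induction k arbitrary: m g)
  case 0
  have "continuous_on A (\<lambda>z. norm z powi (- m) * norm (g z))"
    using 0 assms(3,4) by (auto intro!: continuous_intros intro: continuous_on_subset)
  then have "compact ((\<lambda>z. norm z powi (- m) * norm (g z)) ` A)"
    using assms(2) compact_continuous_image by blast
  from compact_imp_bounded[OF this]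
  obtain C where "C > 0" "\<forall>x\<in>(\<lambda>z. norm z powi (- m) * norm (g z)) ` A. norm x \<le> C"
    unfolding bounded_pos by blast
  then have C: "C > 0" "\<And>z. z \<in> A \<Longrightarrow> norm z powi (- m) * norm (g z) \<le> C"
    by (auto simp: abs_le_iff)
  have "norm (g z) \<le> C * norm z powi m" if "z \<in> A" for z
  proof -
    have "z \<noteq> 0" using that assms(4) by auto
    then show ?thesis using C(2)[OF that] by (simp add: power_int_minus field_simps)
  qed
  moreover have "isCont g z" if "z \<in> A" for z
    using that 0 assms(1,3) continuous_on_eq_continuous_at by force
  ultimately show ?case using C(1) assms(6) by (intro exI[of _ C]) auto
next
  case (Suc k)
  obtain C0 where C0: "0 \<le> C0" "symbol_bound k m C0 W g"
    using Suc.IH[OF Ck_on_SucD[OF Suc.prems]] by blast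
  obtain C1 where C1: "0 \<le> C1" "symbol_bound k (m - 1) C1 W (\<lambda>z. frechet_derivative g (at z) 1)"
    using Suc.IH[where m = "m - 1" and g = "\<lambda>z. frechet_derivative g (at z) 1"] Suc.prems by auto
  obtain C2 where C2: "0 \<le> C2" "symbol_bound k (m - 1) C2 W (\<lambda>z. frechet_derivative g (at z) \<i>)"
    using Suc.IH[where m = "m - 1" and g = "\<lambda>z. frechet_derivative g (at z) \<i>"] Suc.prems by auto
  \<comment> \<open>The induction hypothesis alone gives an unrelated constant for each
    \<open>v\<close>. Real linearity in \<open>v\<close> and the two directions 1 and \<i> give one
    proportional to \<open>norm v\<close>.\<close>
  have D: "symbol_bound k (m - 1) ((C1 + C2) * norm v) W (\<lambda>z. frechet_derivative g (at z) v)" for v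
  proof (rule symbol_bound_cong[OF \<open>open W\<close> order.refl])
    have "symbol_bound k (m - 1) (C1 * norm (of_real (Re v) :: complex) + C2 * norm (of_real (Im v) :: complex)) W
        (\<lambda>z. of_real (Re v) * frechet_derivative g (at z) 1 + of_real (Im v) * frechet_derivative g (at z) \<i>)"
      by (intro symbol_bound_add symbol_bound_cmult C1 C2 assms)
    moreover have "C1 * norm (of_real (Re v) :: complex) + C2 * norm (of_real (Im v) :: complex) \<le> (C1 + C2) * norm v"
      using C1 C2 by (auto simp: distrib_right intro!: add_mono mult_left_mono abs_Re_le_cmod abs_Im_le_cmod)
    ultimately show "symbol_bound k (m - 1) ((C1 + C2) * norm v) W
        (\<lambda>z. of_real (Re v) * frechet_derivative g (at z) 1 + of_real (Im v) * frechet_derivative g (at z) \<i>)"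
      by (rule symbol_bound_mono)
    show "of_real (Re v) * frechet_derivative g (at x) 1 + of_real (Im v) * frechet_derivative g (at x) \<i> =
        frechet_derivative g (at x) v" if "x \<in> W" for x
      using frechet_derivative_complex_eq[of g x v] Suc.prems that assms(3,6) by auto
  qed
  show ?case
  proof (intro exI conjI)
    show "symbol_bound (Suc k) m (C0 + C1 + C2) W g"
      unfolding symbol_bound.simps
    proof (intro conjI ballI allI)
      fix v
      show "symbol_bound k (m - 1) ((C0 + C1 + C2) * norm v) W (\<lambda>z. frechet_derivative g (at z) v)"
        using C0 by (intro symbol_bound_mono[OF D]) (auto intro!: mult_right_mono)
      fix z assume z: "z \<in> W"
      show "norm (g z) \<le> (C0 + C1 + C2) * norm z powi m"
        using C1 C2 by (intro symbol_bound_norm[OF symbol_bound_mono[OF C0(2)] z]) auto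
    qed (use Suc.prems assms(3,6) in auto)
  qed (use C0 C1 C2 in auto)
qed

section \<open>Iterated partial derivatives\<close>

lemma partial_deriv_0 [simp]: "partial_deriv (0, 0) g = g"
  by (simp add: partial_deriv_def)

lemma partial_deriv_Suc_left: "partial_deriv (Suc i, j) g = partial_x (partial_deriv (i, j) g)"
  by (simp add: partial_deriv_def)

lemma partial_deriv_Suc_right: "partial_deriv (i, Suc j) g = partial_deriv (i, j) (partial_y g)"
  by (simp add: partial_deriv_def funpow_Suc_right del: funpow.simps)

lemma partial_deriv_Suc_0: "partial_deriv (Suc i, 0) g = partial_deriv (i, 0) (partial_x g)"
  by (simp add: partial_deriv_def funpow_Suc_right del: funpow.simps)

text \<open>The inner derivatives are taken in \<open>y\<close>, so this is the induction that peels the innermost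
  derivative off \<open>\<partial>\<^sub>x\<^sup>i \<partial>\<^sub>y\<^sup>j g\<close>.\<close>

lemma partial_deriv_induct [case_names zero x y]:
  assumes "\<And>g. P 0 0 g" "\<And>i g. P i 0 (partial_x g) \<Longrightarrow> P (Suc i) 0 g"
    "\<And>i j g. P i j (partial_y g) \<Longrightarrow> P i (Suc j) g"
  shows "P i j g"
proof (induction j arbitrary: g)
  case 0
  show ?case by (induction i arbitrary: g) (use assms in auto)
qed (use assms in auto)

lemma Ck_on_partial_x: "Ck_on (Suc n) V g \<Longrightarrow> Ck_on n V (partial_x g)"
  and Ck_on_partial_y: "Ck_on (Suc n) V g \<Longrightarrow> Ck_on n V (partial_y g)"
  by (simp_all add: partial_x_def partial_y_def)

lemma partial_deriv_cong:
  assumes "open V" "\<And>z. z \<in> V \<Longrightarrow> f z = g z" "z \<in> V"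
  shows "partial_deriv (i, j) f z = partial_deriv (i, j) g z"
proof -
  have x: "\<forall>z\<in>V. partial_x f z = partial_x g z" and y: "\<forall>z\<in>V. partial_y f z = partial_y g z"
    if "\<forall>z\<in>V. f z = g z" for f g
    using frechet_derivative_cong_open[OF assms(1), of _ f g] that
    by (auto simp: partial_x_def partial_y_def)
  have "\<forall>z\<in>V. partial_deriv (i, j) f z = partial_deriv (i, j) g z"
  proof (induction i)
    case 0
    have "\<forall>f g. (\<forall>z\<in>V. f z = g z) \<longrightarrow> (\<forall>z\<in>V. partial_deriv (0, j) f z = partial_deriv (0, j) g z)"
    proof (induction j)
      case (Suc j)
      then show ?case using y unfolding partial_deriv_Suc_right by blast
    qed simp
    then show ?case using assms(2) by blast
  next
    case (Suc i)
    then show ?case using x unfolding partial_deriv_Suc_left by blast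
  qed
  then show ?thesis using assms(3) by blast
qed

lemma partial_deriv_add:
  assumes "open V" "z \<in> V" "Ck_on (i + j) V f" "Ck_on (i + j) V g"
  shows "partial_deriv (i, j) (\<lambda>z. f z + g z) z = partial_deriv (i, j) f z + partial_deriv (i, j) g z"
  using assms(3,4)
proof (induction i j f arbitrary: g rule: partial_deriv_induct)
  case (zero f)
  then show ?case by simp
next
  case (x i f)
  have "partial_deriv (Suc i, 0) (\<lambda>z. f z + g z) z = partial_deriv (i, 0) (\<lambda>z. partial_x f z + partial_x g z) z"
    unfolding partial_deriv_Suc_0
  proof (rule partial_deriv_cong[OF assms(1) _ assms(2)])
    fix w assume w: "w \<in> V"
    have "((\<lambda>z. f z + g z) has_derivative (\<lambda>v. frechet_derivative f (at w) v + frechet_derivative g (at w) v)) (at w)"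
      using x.prems w by (intro has_derivative_add Ck_on_SucE[of "i"]) auto
    then show "partial_x (\<lambda>z. f z + g z) w = partial_x f w + partial_x g w"
      by (simp add: partial_x_def frechet_derivative_at[symmetric])
  qed
  then show ?case
    using x.IH[of "partial_x g"] x.prems by (simp add: Ck_on_partial_x partial_deriv_Suc_0 del: Ck_on.simps)
next
  case (y i j f)
  have "partial_deriv (i, Suc j) (\<lambda>z. f z + g z) z = partial_deriv (i, j) (\<lambda>z. partial_y f z + partial_y g z) z"
    unfolding partial_deriv_Suc_right
  proof (rule partial_deriv_cong[OF assms(1) _ assms(2)])
    fix w assume w: "w \<in> V"
    have "((\<lambda>z. f z + g z) has_derivative (\<lambda>v. frechet_derivative f (at w) v + frechet_derivative g (at w) v)) (at w)"
      using y.prems w by (intro has_derivative_add Ck_on_SucE[of "i + j"]) auto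
    then show "partial_y (\<lambda>z. f z + g z) w = partial_y f w + partial_y g w"
      by (simp add: partial_y_def frechet_derivative_at[symmetric])
  qed
  then show ?case
    using y.IH[of "partial_y g"] y.prems by (simp add: Ck_on_partial_y partial_deriv_Suc_right del: Ck_on.simps)
qed

lemma Ck_on_holomorphic:
  assumes "open V" "f holomorphic_on V"
  shows "Ck_on n V f"
  using assms(2)
proof (induction n arbitrary: f)
  case 0
  then show ?case by (simp add: holomorphic_on_imp_continuous_on)
next
  case (Suc n)
  show ?case
  proof (rule Ck_on_SucI[OF assms(1)])
    fix z assume "z \<in> V"
    then show "(f has_derivative (\<lambda>v. deriv f z * v)) (at z)"
      using holomorphic_derivI[OF Suc.prems assms(1)] has_field_derivative_def by blast
  next
    show "Ck_on n V (\<lambda>z. deriv f z * v)" for v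
      using Suc assms(1) holomorphic_deriv by (intro Ck_on_mult) auto
  qed
qed

lemma partial_deriv_holomorphic:
  assumes "open V" "f holomorphic_on V" "z \<in> V"
  shows "partial_deriv (i, j) f z = \<i> ^ j * (deriv ^^ (i + j)) f z"
  using assms(2)
proof (induction i j f rule: partial_deriv_induct)
  case (zero f)
  then show ?case by simp
next
  case (x i f)
  have eq: "partial_x f w = deriv f w" if "w \<in> V" for w
    using frechet_derivative_at[OF holomorphic_derivI[OF x.prems assms(1) that, unfolded has_field_derivative_def], symmetric]
    by (simp add: partial_x_def)
  then have "partial_x f holomorphic_on V"
    using holomorphic_deriv[OF x.prems assms(1)] by (simp cong: holomorphic_cong)
  from x.IH[OF this] have "partial_deriv (i, 0) (partial_x f) z = (deriv ^^ i) (partial_x f) z"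
    by simp
  also have "\<dots> = (deriv ^^ i) (deriv f) z"
    using assms eq by (intro higher_deriv_cong_ev) (auto simp: eventually_nhds)
  finally show ?case by (simp add: partial_deriv_Suc_0 funpow_Suc_right del: funpow.simps)
next
  case (y i j f)
  have eq: "partial_y f w = \<i> * deriv f w" if "w \<in> V" for w
    using frechet_derivative_at[OF holomorphic_derivI[OF y.prems assms(1) that, unfolded has_field_derivative_def], symmetric]
    by (simp add: partial_y_def)
  have hol: "(\<lambda>w. \<i> * deriv f w) holomorphic_on V"
    by (intro holomorphic_on_mult holomorphic_on_const holomorphic_deriv[OF y.prems assms(1)])
  then have "partial_y f holomorphic_on V"
    using eq by (simp cong: holomorphic_cong)
  from y.IH[OF this] have "partial_deriv (i, j) (partial_y f) z = \<i> ^ j * (deriv ^^ (i + j)) (partial_y f) z" .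
  also have "(deriv ^^ (i + j)) (partial_y f) z = (deriv ^^ (i + j)) (\<lambda>w. \<i> * deriv f w) z"
    using assms eq by (intro higher_deriv_cong_ev) (auto simp: eventually_nhds)
  also have "\<dots> = \<i> * (deriv ^^ (i + j)) (deriv f) z"
    using holomorphic_deriv[OF y.prems assms(1)] assms by (intro higher_deriv_cmult) auto
  finally show ?case by (simp add: partial_deriv_Suc_right funpow_Suc_right algebra_simps del: funpow.simps)
qed

text \<open>If \<open>k\<close> is positive then \<open>m\<close> is at least 2, so \<open>e\<close>
  is O(|z|^2) and has derivative 0 at the origin. Its directional derivatives then vanish at 0 and
  satisfy the hypotheses with \<open>k - 1\<close> and \<open>m - 1\<close>, so the argument
  repeats.\<close>

lemma symbol_bound_extend:
  assumes "symbol_bound k m C (ball 0 r - {0}) e" "e 0 = 0" "int k < m" "0 < r"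
  shows "Ck_on k (ball 0 r) e" "i + j \<le> k \<Longrightarrow> partial_deriv (i, j) e 0 = 0"
proof -
  \<comment> \<open>The radius is capped at 1 because lowering the exponent from \<open>m\<close> to
    \<open>p\<close> requires |z| to be at most 1.\<close>
  have small: "norm (e z) \<le> \<bar>C\<bar> * norm z ^ p"
    if "z \<in> ball 0 (min r 1)" "symbol_bound k m C (ball 0 r - {0}) e" "e 0 = 0" "int p \<le> m" "p > 0"
    for z e C m k p
  proof (cases "z = 0")
    case False
    have "norm (e z) \<le> C * norm z powi m"
      using that False by (intro symbol_bound_norm[OF that(2)]) auto
    also have "\<dots> \<le> \<bar>C\<bar> * norm z powi int p"
      using that False by (intro mult_mono power_int_decreasing) auto
    finally show ?thesis by simp
  qed (use that in auto)
  have "Ck_on k (ball 0 r) e \<and> (\<forall>i j. i + j \<le> k \<longrightarrow> partial_deriv (i, j) e 0 = 0)"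
    using assms(1-3)
  proof (induction k arbitrary: m C e)
    case 0
    have ev: "eventually (\<lambda>z. norm (e z) \<le> \<bar>C\<bar> * norm z) (at 0)"
      unfolding eventually_at_topological
      using small[OF _ 0(1,2), of _ 1] 0(3) assms(4) by (intro exI[of _ "ball 0 (min r 1)"]) auto
    have "((\<lambda>z::complex. \<bar>C\<bar> * norm z) \<longlongrightarrow> 0) (at 0)"
      by (auto intro!: tendsto_eq_intros)
    then have "(e \<longlongrightarrow> 0) (at 0)" by (rule Lim_null_comparison[OF ev])
    then have "isCont e 0" using 0 by (simp add: isCont_def)
    then have "isCont e z" if "z \<in> ball 0 r" for z
      using 0 that by (cases "z = 0") auto
    then show ?case using 0 by (auto intro: continuous_at_imp_continuous_on)
  next
    case (Suc k)
    have d0: "(e has_derivative (\<lambda>_. 0)) (at 0)"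
    proof (rule has_derivativeI_sandwich[where e = "min r 1" and H = "\<lambda>z. \<bar>C\<bar> * norm z"])
      show "((\<lambda>z::complex. \<bar>C\<bar> * norm z) \<longlongrightarrow> 0) (at 0)"
        by (auto intro!: tendsto_eq_intros)
      fix z :: complex assume z: "z \<noteq> 0" "dist z 0 < min r 1"
      then have "norm (e z) \<le> \<bar>C\<bar> * norm z ^ 2"
        using Suc.prems by (intro small[OF _ Suc.prems(1,2)]) auto
      then show "norm (e z - e 0 - 0) / norm (z - 0) \<le> \<bar>C\<bar> * norm z"
        using z Suc.prems by (simp add: field_simps power2_eq_square)
    qed (use assms in auto)
    have IH: "Ck_on k (ball 0 r) (\<lambda>z. frechet_derivative e (at z) v) \<and>
       (\<forall>i j. i + j \<le> k \<longrightarrow> partial_deriv (i, j) (\<lambda>z. frechet_derivative e (at z) v) 0 = 0)" for v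
    proof (rule Suc.IH)
      show "symbol_bound k (m - 1) (C * norm v) (ball 0 r - {0}) (\<lambda>z. frechet_derivative e (at z) v)"
        using Suc.prems by simp
      show "frechet_derivative e (at 0) v = 0"
        using frechet_derivative_at[OF d0, symmetric] by simp
    qed (use Suc.prems in simp)
    have "e differentiable (at z)" if "z \<in> ball 0 r" for z
      using d0 Suc.prems that by (cases "z = 0") (auto simp: differentiable_def)
    moreover have "partial_deriv (i, j) e 0 = 0" if "i + j \<le> Suc k" for i j
    proof (cases j)
      case (Suc j')
      then show ?thesis using IH[of \<i>] that by (simp add: partial_deriv_Suc_right partial_y_def)
    next
      case 0
      then show ?thesis using IH[of 1] that Suc.prems
        by (cases i) (simp_all add: partial_deriv_Suc_0 partial_x_def)
    qed
    ultimately show ?case using IH by simp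
  qed
  then show "Ck_on k (ball 0 r) e" "i + j \<le> k \<Longrightarrow> partial_deriv (i, j) e 0 = 0" by auto
qed

lemma symbol_bound_power: "\<exists>D\<ge>0. symbol_bound k (int p) D (UNIV - {0}) (\<lambda>z. z ^ p)"
proof (induction p)
  case 0
  then show ?case using symbol_bound_const[of k 1] by (intro exI[of _ 1]) auto
next
  case (Suc p)
  then obtain D where D: "D \<ge> 0" "symbol_bound k (int p) D (UNIV - {0}) (\<lambda>z. z ^ p)" by blast
  have "symbol_bound k (1 + int p) (2 ^ k * 1 * D) (UNIV - {0}) (\<lambda>z. z * z ^ p)"
    using D by (intro symbol_bound_mult symbol_bound_ident open_delete) auto
  then show ?case using D by (intro exI[of _ "2 ^ k * 1 * D"]) auto
qed

text \<open>All derivatives vanish where \<open>b\<close> is constant, near 0 and far out. Only an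
  annulus remains; its bounds are slightly widened so that the three open regions cover the
  punctured plane.\<close>

lemma bump_symbol_bound:
  assumes "Ck_on k UNIV b" "\<And>z. norm z < r \<Longrightarrow> b z = c" "\<And>z. norm z > R \<Longrightarrow> b z = 0" "0 < r"
  shows "\<exists>B\<ge>0. symbol_bound k 0 B (UNIV - {0}) b"
proof -
  define A where "A = {z::complex. r / 2 \<le> norm z \<and> norm z \<le> R + 1}"
  define W where "W = {z::complex. r / 2 < norm z \<and> norm z < R + 1}"
  have "A = cball 0 (R + 1) - ball 0 (r / 2)" by (auto simp: A_def)
  then have "compact A" by (auto intro: compact_diff)
  moreover have "open W"
    unfolding W_def by (intro open_Collect_conj open_Collect_less continuous_intros)
  moreover have "W \<subseteq> A" "0 \<notin> A" using assms(4) by (auto simp: W_def A_def)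
  ultimately obtain B where B: "B \<ge> 0" "symbol_bound k 0 B W b"
    using Ck_on_imp_symbol_bound[OF open_UNIV _ _ _ _ _ assms(1), of A W] by auto
  have 1: "symbol_bound k 0 (B + norm c) (ball 0 r) b"
  proof (rule symbol_bound_cong[OF open_ball order.refl])
    show "symbol_bound k 0 (B + norm c) (ball 0 r) (\<lambda>_. c)"
      by (rule symbol_bound_mono[OF symbol_bound_const]) (use B in simp)
  qed (use assms in auto)
  have 2: "symbol_bound k 0 (B + norm c) {z. norm z > R} b"
  proof (rule symbol_bound_cong[OF _ order.refl])
    show "open {z::complex. norm z > R}" by (intro open_Collect_less continuous_intros)
    show "symbol_bound k 0 (B + norm c) {z. norm z > R} (\<lambda>_. 0)"
      by (rule symbol_bound_0) (use B in simp)
  qed (use assms in auto)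
  have 3: "symbol_bound k 0 (B + norm c) W b"
    by (rule symbol_bound_mono[OF B(2)]) simp
  have "UNIV - {0} \<subseteq> ball 0 r \<union> {z. norm z > R} \<union> W"
    using assms(4) by (auto simp: W_def)
  with symbol_bound_Un[OF symbol_bound_Un[OF 1 2] 3] have "symbol_bound k 0 (B + norm c) (UNIV - {0}) b"
    by (rule symbol_bound_subset)
  then show ?thesis using B by (intro exI[of _ "B + norm c"]) auto
qed

section \<open>Borel summation\<close>

text \<open>Giving up one power of |z| frees a factor |z|, which is O(\<epsilon>) on the support of
  the term. As the constant of the full-order estimate is the same for all \<epsilon>, a small
  \<epsilon> brings it below 2^(-p), hence to a summable size. Controlling \<open>p\<close>
  derivatives of the term of index \<open>p\<close> is enough, since a fixed \<open>k\<close> then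
  fails to be covered by finitely many terms only.\<close>

lemma borel_term:
  fixes b :: "complex \<Rightarrow> complex" and a :: complex
  assumes "Ck_on p UNIV b" "\<And>z. norm z < 1/2 \<Longrightarrow> b z = 1" "\<And>z. norm z \<ge> 1 \<Longrightarrow> b z = 0" "0 < r"
  shows "\<exists>\<epsilon>>0. \<epsilon> \<le> r \<and> symbol_bound p (int p - 1) ((1/2) ^ p) (UNIV - {0}) (\<lambda>z. a * (z ^ p * b (inverse (of_real \<epsilon>) * z)))"
proof -
  obtain B where B: "B \<ge> 0" "symbol_bound p 0 B (UNIV - {0}) b"
    using bump_symbol_bound[OF assms(1), of "1/2" 1 1] assms(2,3) by auto
  obtain D where D: "D \<ge> 0" "symbol_bound p (int p) D (UNIV - {0}) (\<lambda>z. z ^ p)"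
    using symbol_bound_power by blast
  define M where "M = 2 ^ p * D * B * norm a"
  \<comment> \<open>Chosen so that \<open>M * (2 * \<epsilon>)\<close> is at most (1/2)^p; adding 1
    to \<open>M\<close> keeps the denominator positive when \<open>M\<close> is 0.\<close>
  define y where "y = (1/2) ^ p / (M + 1)"
  define \<delta> where "\<delta> = y / 2"
  define \<epsilon> where "\<epsilon> = min r \<delta>"
  have M: "M \<ge> 0" using B D by (simp add: M_def)
  then have nz: "M + 1 \<noteq> 0" and \<delta>: "\<delta> > 0" by (auto simp: \<delta>_def y_def)
  have \<delta>2: "2 * \<delta> = y" by (simp add: \<delta>_def)
  have \<epsilon>: "\<epsilon> > 0" "\<epsilon> \<le> r" using assms(4) \<delta> by (auto simp: \<epsilon>_def)
  have "M * (2 * \<epsilon>) \<le> (M + 1) * (2 * \<delta>)" using M \<epsilon>(1) by (intro mult_mono) (auto simp: \<epsilon>_def)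
  then have M\<epsilon>: "M * (2 * \<epsilon>) \<le> (1/2) ^ p" unfolding \<delta>2 y_def using nz by simp
  let ?c = "inverse (complex_of_real \<epsilon>)"
  let ?t = "\<lambda>z. a * (z ^ p * b (?c * z))"
  have "{z. ?c * z \<in> UNIV - {0}} = UNIV - {0}" using \<epsilon> by auto
  then have "symbol_bound p 0 B (UNIV - {0}) (\<lambda>z. b (?c * z))"
    using symbol_bound_scale[OF _ B(2), of ?c] \<epsilon> by (simp add: open_delete)
  then have "symbol_bound p (int p + 0) (2 ^ p * D * B) (UNIV - {0}) (\<lambda>z. z ^ p * b (?c * z))"
    using B D by (intro symbol_bound_mult) (auto simp: open_delete)
  then have t: "symbol_bound p (int p) M (UNIV - {0}) ?t"
    unfolding M_def by (intro symbol_bound_cmult) (auto simp: open_delete)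
  \<comment> \<open>The term vanishes beyond radius \<epsilon>. Radius 2 \<epsilon> is taken here so
    that this disc and the exterior region overlap and cover the punctured plane.\<close>
  have near: "symbol_bound p (int p - 1) ((1/2) ^ p) (ball 0 (2 * \<epsilon>) - {0}) ?t"
  proof (rule symbol_bound_weaken)
    show "symbol_bound p (int p) M (ball 0 (2 * \<epsilon>) - {0}) ?t"
      by (rule symbol_bound_subset[OF t]) auto
    fix z :: complex and j assume z: "z \<in> ball 0 (2 * \<epsilon>) - {0}"
    have "M * norm z powi (int p - int j) = (M * norm z) * norm z powi (int p - 1 - int j)"
      using z power_int_add_1'[of "norm z" "int p - 1 - int j"] by (simp add: algebra_simps)
    also have "\<dots> \<le> (1/2) ^ p * norm z powi (int p - 1 - int j)"
      using z M M\<epsilon> mult_left_mono[of "norm z" "2 * \<epsilon>" M] by (intro mult_right_mono) auto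
    finally show "M * norm z powi (int p - int j) \<le> (1/2) ^ p * norm z powi (int p - 1 - int j)" .
  qed
  have far: "symbol_bound p (int p - 1) ((1/2) ^ p) {z. norm z > \<epsilon>} ?t"
  proof (rule symbol_bound_cong[OF _ order.refl])
    show "open {z::complex. norm z > \<epsilon>}" by (intro open_Collect_less continuous_intros)
    show "symbol_bound p (int p - 1) ((1/2) ^ p) {z. norm z > \<epsilon>} (\<lambda>_. 0)"
      by (rule symbol_bound_0) simp
    show "0 = ?t z" if "z \<in> {z. norm z > \<epsilon>}" for z
    proof -
      have "norm (?c * z) \<ge> 1" using that \<epsilon> by (simp add: norm_divide field_simps)
      then show ?thesis by (simp add: assms(3))
    qed
  qed
  have "UNIV - {0} \<subseteq> (ball 0 (2 * \<epsilon>) - {0}) \<union> {z::complex. norm z > \<epsilon>}"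
    using \<epsilon>(1) by (auto simp: not_less)
  with symbol_bound_Un[OF near far] have "symbol_bound p (int p - 1) ((1/2) ^ p) (UNIV - {0}) ?t"
    by (rule symbol_bound_subset)
  then show ?thesis using \<epsilon> by blast
qed

text \<open>The cutoff radii tend to 0, so the sum is finite away from 0 and smooth there. Near 0
  the first terms are exact monomials, and the remaining ones have summable constants and high
  order.\<close>

lemma ex_borel_sum:
  fixes a :: "nat \<Rightarrow> complex"
  shows "\<exists>h. (\<forall>k. Ck_on k (UNIV - {0}) h) \<and>
    (\<forall>n k. \<exists>\<epsilon>>0. \<exists>C\<ge>0. symbol_bound k (int n) C (ball 0 \<epsilon> - {0}) (\<lambda>z. h z - (\<Sum>p<n. a p * z ^ p)))"
proof -
  obtain b :: "complex \<Rightarrow> complex" where b: "\<And>k. Ck_on k UNIV b"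
    "\<And>z. (norm z)\<^sup>2 \<le> 1 / 2 \<Longrightarrow> b z = 1" "\<And>z. norm z \<ge> 1 \<Longrightarrow> b z = 0"
    using ex_smooth_bump by blast
  have b1: "b z = 1" if "norm z < 1/2" for z
    using that power_mono[of "norm z" "1/2" 2] by (intro b(2)) (simp add: power2_eq_square)
  have "\<exists>e. \<forall>p. e p > 0 \<and> e p \<le> 1 / real (Suc p) \<and> symbol_bound p (int p - 1) ((1/2) ^ p) (UNIV - {0})
      (\<lambda>z. a p * (z ^ p * b (inverse (of_real (e p)) * z)))"
    using borel_term[OF b(1) b1 b(3)] by (intro choice allI) simp
  then obtain e where e: "\<And>p. e p > 0" "\<And>p. e p \<le> 1 / real (Suc p)"
    and te: "\<And>p. symbol_bound p (int p - 1) ((1/2) ^ p) (UNIV - {0})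
      (\<lambda>z. a p * (z ^ p * b (inverse (of_real (e p)) * z)))"
    by blast
  define t where "t p z = a p * (z ^ p * b (inverse (of_real (e p)) * z))" for p z
  note te = te[folded t_def]
  have t0: "t p z = 0" if "norm z \<ge> e p" for p z
  proof -
    have "norm (inverse (complex_of_real (e p)) * z) \<ge> 1"
      using that e(1)[of p] by (simp add: norm_mult norm_inverse norm_divide field_simps)
    then show ?thesis by (simp add: t_def b(3))
  qed
  have t1: "t p z = a p * z ^ p" if "norm z < e p / 2" for p z
  proof -
    have "norm (inverse (complex_of_real (e p)) * z) < 1 / 2"
      using that e(1)[of p] by (simp add: norm_mult norm_inverse norm_divide field_simps)
    then show ?thesis by (simp add: t_def b1)
  qed
  have t_Ck: "Ck_on k UNIV (t p)" for k p
  proof -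
    have "Ck_on k UNIV (\<lambda>z. b (inverse (complex_of_real (e p)) * z + 0))"
      by (rule Ck_on_affine[OF b(1)]) auto
    moreover have "Ck_on k UNIV (\<lambda>z::complex. z ^ p)"
      by (intro Ck_on_holomorphic holomorphic_intros open_UNIV)
    ultimately show ?thesis
      unfolding t_def by (intro Ck_on_mult Ck_on_const open_UNIV) simp_all
  qed
  \<comment> \<open>For z different from 0 only finitely many terms are nonzero, because
    \<open>t p\<close> vanishes beyond radius \<open>e p\<close>, which is at most 1/(p +
    1).\<close>
  define h where "h z = (\<Sum>p | t p z \<noteq> 0. t p z)" for z
  have h_eq: "\<exists>N. \<forall>M\<ge>N. \<forall>z. norm z > s \<longrightarrow> h z = (\<Sum>p<M. t p z)" if s: "s > 0" for s
  proof -
    obtain N where N: "1 / real (Suc N) < s" using s reals_Archimedean by (auto simp: inverse_eq_divide)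
    have z0: "t p z = 0" if "p \<ge> N" "norm z > s" for p z
    proof (rule t0)
      have "1 / real (Suc p) \<le> 1 / real (Suc N)" using that by (intro divide_left_mono) auto
      then show "norm z \<ge> e p" using e(2)[of p] N that by linarith
    qed
    have "h z = (\<Sum>p<M. t p z)" if M: "M \<ge> N" "norm z > s" for M z
      unfolding h_def
    proof (rule sum.mono_neutral_left)
      show "{p. t p z \<noteq> 0} \<subseteq> {..<M}"
      proof
        fix p assume "p \<in> {p. t p z \<noteq> 0}"
        then have "\<not> N \<le> p" using z0[OF _ M(2), of p] by auto
        then show "p \<in> {..<M}" using M(1) by simp
      qed
    qed (use z0 M in auto)
    then show ?thesis by blast
  qed
  have open_far: "open {w::complex. norm w > s}" for s
    by (intro open_Collect_less continuous_intros)
  have "Ck_on k (UNIV - {0}) h" for k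
  proof (rule Ck_on_locally)
    fix z :: complex assume "z \<in> UNIV - {0}"
    then have s: "norm z / 2 > 0" by simp
    obtain N where N: "\<And>w. norm w > norm z / 2 \<Longrightarrow> h w = (\<Sum>p<N. t p w)"
      using h_eq[OF s] by blast
    have "Ck_on k {w. norm w > norm z / 2} h"
    proof (rule Ck_on_cong[OF open_far])
      show "Ck_on k {w. norm w > norm z / 2} (\<lambda>w. \<Sum>p<N. t p w)"
        by (intro Ck_on_sum open_far Ck_on_mono[OF t_Ck]) auto
    qed (use N in auto)
    then show "\<exists>W. open W \<and> z \<in> W \<and> Ck_on k W h"
      using s by (intro exI[of _ "{w. norm w > norm z / 2}"] conjI open_far) auto
  qed
  moreover have "\<exists>\<epsilon>>0. \<exists>C\<ge>0. symbol_bound k (int n) C (ball 0 \<epsilon> - {0}) (\<lambda>z. h z - (\<Sum>p<n. a p * z ^ p))" for n k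
  proof -
    \<comment> \<open>For \<open>p\<close> at least \<open>N\<close>, both
      \<open>int n \<le> int p - 1\<close> and \<open>k \<le> p\<close> hold, so \<open>te\<close>
      covers the required order and number of derivatives.\<close>
    define N where "N = Suc (max n k)"
    \<comment> \<open>Below \<open>e p / 2\<close> the term \<open>t p\<close> equals its monomial;
      the bound 1 permits lowering exponents.\<close>
    define \<epsilon> where "\<epsilon> = Min (insert 1 ((\<lambda>p. e p / 2) ` {..<N}))"
    have \<epsilon>: "\<epsilon> > 0" "\<epsilon> \<le> 1"
      unfolding \<epsilon>_def using e(1) by auto
    have \<epsilon>e: "\<epsilon> \<le> e p / 2" if "p < N" for p
      unfolding \<epsilon>_def using that by (intro Min_le) blast+
    have weak: "symbol_bound k (int n) C (ball 0 \<epsilon> - {0}) f"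
      if "symbol_bound k m C (ball 0 \<epsilon> - {0}) f" "int n \<le> m" "C \<ge> 0" for f C m
      using that \<epsilon>(2) by (intro symbol_bound_weaken[OF that(1)] mult_left_mono power_int_decreasing) auto
    have "\<exists>D\<ge>0. symbol_bound k (int n) D (ball 0 \<epsilon> - {0}) (\<lambda>z. a p * z ^ p)" if "p \<ge> n" for p
    proof -
      obtain D where D: "D \<ge> 0" "symbol_bound k (int p) D (UNIV - {0}) (\<lambda>z. z ^ p)"
        using symbol_bound_power by blast
      have "symbol_bound k (int p) (D * norm (a p)) (UNIV - {0}) (\<lambda>z. a p * z ^ p)"
        using D by (intro symbol_bound_cmult) (auto simp: open_delete)
      then have "symbol_bound k (int n) (D * norm (a p)) (ball 0 \<epsilon> - {0}) (\<lambda>z. a p * z ^ p)"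
        using that D by (intro weak[where m = "int p"]) (auto elim: symbol_bound_subset)
      then show ?thesis using D by (intro exI[of _ "D * norm (a p)"]) auto
    qed
    then obtain D where D: "\<And>p. p \<ge> n \<Longrightarrow> D p \<ge> 0"
      "\<And>p. p \<ge> n \<Longrightarrow> symbol_bound k (int n) (D p) (ball 0 \<epsilon> - {0}) (\<lambda>z. a p * z ^ p)"
      by metis
    have tail: "symbol_bound k (int n) ((1/2) ^ p) (ball 0 \<epsilon> - {0}) (t p)" if "p \<ge> N" for p
    proof (rule weak)
      show "symbol_bound k (int p - 1) ((1/2) ^ p) (ball 0 \<epsilon> - {0}) (t p)"
        using that by (intro symbol_bound_le[OF symbol_bound_subset[OF te]]) (auto simp: N_def)
    qed (use that in \<open>auto simp: N_def\<close>)
    have "symbol_bound k (int n) (sum D {n..<N} + 2) (ball 0 \<epsilon> - {0}) (\<lambda>z. h z - (\<Sum>p<n. a p * z ^ p))"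
    \<comment> \<open>The number \<open>M\<close> of terms present depends on z, but the geometric
      series keeps their total constant below 2, uniformly in z.\<close>
    proof (rule symbol_bound_Union)
      fix z :: complex assume z: "z \<in> ball 0 \<epsilon> - {0}"
      then have s: "norm z / 2 > 0" by simp
      obtain M0 where "\<And>w M. M \<ge> M0 \<Longrightarrow> norm w > norm z / 2 \<Longrightarrow> h w = (\<Sum>p<M. t p w)"
        using h_eq[OF s] by blast
      then obtain M where M: "M \<ge> N" "\<And>w. norm w > norm z / 2 \<Longrightarrow> h w = (\<Sum>p<M. t p w)"
        by (metis nat_le_linear)
      define W where "W = (ball 0 \<epsilon> - {0}) \<inter> {w::complex. norm w > norm z / 2}"
      have "open W" unfolding W_def by (intro open_Int open_delete open_ball open_far)
      moreover have "W \<subseteq> ball 0 \<epsilon> - {0}" "z \<in> W" using z unfolding W_def by auto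
      ultimately have W: "open W" "W \<subseteq> ball 0 \<epsilon> - {0}" "z \<in> W" by blast+
      have "symbol_bound k (int n) (sum D {n..<N} + (\<Sum>p\<in>{N..<M}. (1/2) ^ p)) W
          (\<lambda>w. (\<Sum>p\<in>{n..<N}. a p * w ^ p) + (\<Sum>p\<in>{N..<M}. t p w))"
        by (intro symbol_bound_add symbol_bound_sum W(1) symbol_bound_subset[OF _ W(2)] D tail) auto
      moreover have "(\<Sum>p\<in>{N..<M}. (1/2) ^ p) \<le> (2::real)"
      proof -
        have "(\<Sum>p\<in>{N..<M}. (1/2) ^ p) \<le> (\<Sum>p<M. (1/2::real) ^ p)"
          by (intro sum_mono2) auto
        also have "\<dots> \<le> 2" by (simp add: geometric_sum)
        finally show ?thesis .
      qed
      ultimately have "symbol_bound k (int n) (sum D {n..<N} + 2) W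
          (\<lambda>w. (\<Sum>p\<in>{n..<N}. a p * w ^ p) + (\<Sum>p\<in>{N..<M}. t p w))"
        by - (erule symbol_bound_mono, simp)
      then have "symbol_bound k (int n) (sum D {n..<N} + 2) W (\<lambda>z. h z - (\<Sum>p<n. a p * z ^ p))"
      proof (rule symbol_bound_cong[OF W(1) order.refl, rotated])
        fix w assume w: "w \<in> W"
        have "h w = (\<Sum>p<M. t p w)" using w M by (auto simp: W_def)
        also have "\<dots> = (\<Sum>p<N. t p w) + (\<Sum>p\<in>{N..<M}. t p w)"
          using M(1) by (simp add: lessThan_atLeast0 sum.atLeastLessThan_concat)
        also have "(\<Sum>p<N. t p w) = (\<Sum>p<N. a p * w ^ p)"
        proof (rule sum.cong)
          fix p assume "p \<in> {..<N}"
          then show "t p w = a p * w ^ p" using w \<epsilon>e[of p] by (intro t1) (auto simp: W_def)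
        qed simp
        also have "\<dots> = (\<Sum>p<n. a p * w ^ p) + (\<Sum>p\<in>{n..<N}. a p * w ^ p)"
          by (simp add: N_def lessThan_atLeast0 sum.atLeastLessThan_concat)
        finally show "(\<Sum>p\<in>{n..<N}. a p * w ^ p) + (\<Sum>p\<in>{N..<M}. t p w) = h w - (\<Sum>p<n. a p * w ^ p)"
          by simp
      qed
      then show "\<exists>W. z \<in> W \<and> symbol_bound k (int n) (sum D {n..<N} + 2) W (\<lambda>z. h z - (\<Sum>p<n. a p * z ^ p))"
        using W(3) by blast
    qed
    moreover have "sum D {n..<N} + 2 \<ge> 0" using D(1) by (intro add_nonneg_nonneg sum_nonneg) auto
    ultimately show ?thesis using \<epsilon>(1) by blast
  qed
  ultimately show ?thesis by blast
qed

section \<open>Invariant sets and cutoffs\<close>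

definition q_orbit :: "complex \<Rightarrow> complex set \<Rightarrow> complex set" where
  "q_orbit q A = (\<Union>n. (\<lambda>z. inverse q ^ n * z) ` A)"

lemma invariant_strict_subset_iff:
  "invariant_strict_subset q U K \<longleftrightarrow> (\<exists>A. compact A \<and> A \<subseteq> U \<and> K = q_orbit q A)"
  by (simp add: invariant_strict_subset_def q_orbit_def)

lemma q_orbit_iff:
  assumes "q \<noteq> 0"
  shows "z \<in> q_orbit q A \<longleftrightarrow> (\<exists>n. q ^ n * z \<in> A)"
proof
  assume "\<exists>n. q ^ n * z \<in> A"
  then obtain n where n: "q ^ n * z \<in> A" by blast
  have "z = inverse q ^ n * (q ^ n * z)" using assms by (simp add: power_inverse)
  then show "z \<in> q_orbit q A" unfolding q_orbit_def using n by blast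
next
  assume "z \<in> q_orbit q A"
  then obtain n w where "w \<in> A" "z = inverse q ^ n * w" unfolding q_orbit_def by blast
  then have "q ^ n * z = w" using assms by (simp add: power_inverse)
  then show "\<exists>n. q ^ n * z \<in> A" using \<open>w \<in> A\<close> by blast
qed

lemma q_orbit_mono: "A \<subseteq> B \<Longrightarrow> q_orbit q A \<subseteq> q_orbit q B"
  unfolding q_orbit_def by blast

lemma q_orbit_Un: "q_orbit q (A \<union> B) = q_orbit q A \<union> q_orbit q B"
  unfolding q_orbit_def by blast

lemma subset_q_orbit: "A \<subseteq> q_orbit q A"
proof
  fix z assume "z \<in> A"
  then have "z \<in> (\<lambda>z. inverse q ^ 0 * z) ` A" by simp
  then show "z \<in> q_orbit q A" unfolding q_orbit_def by blast
qed

lemma q_orbit_subset: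
  assumes "(\<lambda>z. inverse q * z) ` U \<subseteq> U" "A \<subseteq> U"
  shows "q_orbit q A \<subseteq> U"
proof -
  have "inverse q ^ n * z \<in> U" if "z \<in> U" for n z
    using that
  proof (induction n)
    case (Suc n)
    then have "inverse q * (inverse q ^ n * z) \<in> U" using assms(1) by blast
    then show ?case by (simp add: mult.assoc)
  qed simp
  then show ?thesis using assms(2) unfolding q_orbit_def by blast
qed

lemma open_q_orbit:
  assumes "q \<noteq> 0" "open A"
  shows "open (q_orbit q A)"
proof -
  have "q_orbit q A = (\<Union>n. (\<lambda>z. q ^ n * z) -` A)"
    using q_orbit_iff[OF assms(1)] by auto
  moreover have "open ((\<lambda>z. q ^ n * z) -` A)" for n
    by (intro open_vimage assms continuous_intros)
  ultimately show ?thesis by auto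
qed

lemma q_power_escapes:
  fixes q :: complex
  assumes "norm q > 1" "bounded A" "s > 0"
  shows "\<exists>N. \<forall>n\<ge>N. \<forall>z. norm z \<ge> s \<longrightarrow> q ^ n * z \<notin> A"
proof -
  obtain R where R: "\<And>z. z \<in> A \<Longrightarrow> norm z \<le> R"
    using assms(2) unfolding bounded_iff by blast
  obtain N where N: "R / s < norm q ^ N"
    using real_arch_pow[OF assms(1)] by blast
  have "q ^ n * z \<notin> A" if "n \<ge> N" "norm z \<ge> s" for n z
  proof
    assume "q ^ n * z \<in> A"
    then have "norm q ^ n * norm z \<le> R" using R[of "q ^ n * z"] by (simp add: norm_mult norm_power)
    moreover have "norm q ^ N * s \<le> norm q ^ n * norm z"
      using that assms by (intro mult_mono power_increasing) auto
    moreover have "R < norm q ^ N * s" using N assms(3) by (simp add: field_simps)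
    ultimately show False by linarith
  qed
  then show ?thesis by blast
qed

text \<open>Multiplication by powers of \<open>q\<close> carries all points with |z| at least
  \<open>s\<close> out of \<open>A\<close> after a bounded number of steps, so finitely many copies
  of \<open>A\<close> account for this part of the orbit.\<close>

lemma q_orbit_compact_part:
  assumes "norm q > 1" "compact A" "s > 0"
  shows "\<exists>M. compact M \<and> M \<subseteq> q_orbit q A \<and> (\<forall>z\<in>q_orbit q A. norm z \<ge> s \<longrightarrow> z \<in> M)"
proof -
  have q: "q \<noteq> 0" using assms(1) by auto
  obtain N where N: "\<And>n z. n \<ge> N \<Longrightarrow> norm z \<ge> s \<Longrightarrow> q ^ n * z \<notin> A"
    using q_power_escapes[OF assms(1) compact_imp_bounded[OF assms(2)] assms(3)] by blast
  define M where "M = (\<Union>n<N. (\<lambda>z. inverse q ^ n * z) ` A)"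
  have "compact M"
    unfolding M_def by (intro compact_UN compact_continuous_image assms continuous_intros) auto
  moreover have "M \<subseteq> q_orbit q A" unfolding M_def q_orbit_def by blast
  moreover have "z \<in> M" if z: "z \<in> q_orbit q A" "norm z \<ge> s" for z
  proof -
    obtain n where n: "q ^ n * z \<in> A" using z(1) unfolding q_orbit_iff[OF q] by blast
    then have "n < N" using N[of n z] z(2) by (meson not_le)
    moreover have "z = inverse q ^ n * (q ^ n * z)" using q by (simp add: power_inverse)
    ultimately show ?thesis using n unfolding M_def by blast
  qed
  ultimately show ?thesis by blast
qed

text \<open>The orbit of a compact set can accumulate outside itself only at 0. Openness of the
  complement is what allows a function cut off along the orbit to be differentiated there.\<close>

lemma open_compl_q_orbit:
  assumes "norm q > 1" "compact A"
  shows "open (UNIV - {0} - q_orbit q A)"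
proof (subst open_subopen, intro ballI)
  fix z assume z: "z \<in> UNIV - {0} - q_orbit q A"
  then obtain M where M: "compact M" "M \<subseteq> q_orbit q A"
      "\<And>w. w \<in> q_orbit q A \<Longrightarrow> norm w \<ge> norm z / 2 \<Longrightarrow> w \<in> M"
    using q_orbit_compact_part[OF assms, of "norm z / 2"] by auto
  let ?T = "{w. norm w > norm z / 2} - M"
  have "open ?T"
    by (intro open_Diff open_Collect_less continuous_intros compact_imp_closed M)
  moreover have "z \<in> ?T" using z M(2) by auto
  moreover have "?T \<subseteq> UNIV - {0} - q_orbit q A"
  proof
    fix w assume w: "w \<in> ?T"
    then have "w \<notin> q_orbit q A" using M(3)[of w] by auto
    then show "w \<in> UNIV - {0} - q_orbit q A" using w by auto
  qed
  ultimately show "\<exists>T. open T \<and> z \<in> T \<and> T \<subseteq> UNIV - {0} - q_orbit q A" by blast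
qed

section \<open>Smooth and invariant cutoffs\<close>

lemma ex_smooth_cutoff:
  fixes K U :: "complex set"
  assumes "compact K" "open U" "K \<subseteq> U"
  shows "\<exists>P S V. (\<forall>k. Ck_on k UNIV P) \<and> compact S \<and> S \<subseteq> U \<and> open V \<and> K \<subseteq> V \<and>
    (\<forall>z\<in>V. P z = (0::complex)) \<and> (\<forall>z. z \<notin> S \<longrightarrow> P z = 1)"
proof -
  obtain b :: "complex \<Rightarrow> complex" where b: "\<And>k. Ck_on k UNIV b"
    "\<And>z. (norm z)\<^sup>2 \<le> 1 / 2 \<Longrightarrow> b z = 1" "\<And>z. norm z \<ge> 1 \<Longrightarrow> b z = 0"
    using ex_smooth_bump by blast
  have "\<forall>x\<in>K. \<exists>r>0. cball x r \<subseteq> U"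
    using assms open_contains_cball by blast
  then obtain r where r: "\<And>x. x \<in> K \<Longrightarrow> r x > 0" "\<And>x. x \<in> K \<Longrightarrow> cball x (r x) \<subseteq> U"
    by metis
  obtain C where C: "C \<subseteq> K" "finite C" "K \<subseteq> (\<Union>x\<in>C. ball x (r x / 2))"
  proof (rule compactE_image[OF assms(1), of K "\<lambda>x. ball x (r x / 2)"])
    show "K \<subseteq> (\<Union>x\<in>K. ball x (r x / 2))" using r(1) by force
  qed auto
  let ?w = "\<lambda>x z. inverse (complex_of_real (r x)) * z + - (x / of_real (r x))"
  have w: "norm (?w x z) = dist x z / r x" if "x \<in> C" for x z
  proof -
    have "?w x z = (z - x) / of_real (r x)" by (simp add: divide_inverse left_diff_distrib mult.commute)
    moreover have "r x > 0" using that C r by auto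
    ultimately show ?thesis by (simp only: norm_divide norm_of_real) (simp add: dist_norm norm_minus_commute)
  qed
  \<comment> \<open>This is the complement of a usual cutoff: in a product, one vanishing factor
    suffices near \<open>K\<close>, and all factors are 1 away from the covering discs.\<close>
  define P where "P z = (\<Prod>x\<in>C. 1 - b (?w x z))" for z
  show ?thesis
  proof (intro exI conjI allI ballI impI)
    show "Ck_on k UNIV P" for k
      unfolding P_def by (intro Ck_on_prod Ck_on_diff Ck_on_const open_UNIV Ck_on_affine[OF b(1)]) auto
    show "compact (\<Union>x\<in>C. cball x (r x))" using C by (intro compact_UN) auto
    show "(\<Union>x\<in>C. cball x (r x)) \<subseteq> U" using C r by blast
    show "open (\<Union>x\<in>C. ball x (r x / 2))" by blast
    show "K \<subseteq> (\<Union>x\<in>C. ball x (r x / 2))" by fact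
  next
    fix z assume "z \<in> (\<Union>x\<in>C. ball x (r x / 2))"
    then obtain x where x: "x \<in> C" "dist x z < r x / 2" by auto
    then have "norm (?w x z) \<le> 1 / 2" unfolding w[OF x(1)] using C r by (auto simp: field_simps)
    then have "(norm (?w x z))\<^sup>2 \<le> (1 / 2)\<^sup>2" by (intro power_mono) auto
    then have "b (?w x z) = 1" by (intro b(2)) (simp add: power2_eq_square)
    then show "P z = 0" unfolding P_def using x(1) C(2) by (intro prod_zero) auto
  next
    fix z assume z: "z \<notin> (\<Union>x\<in>C. cball x (r x))"
    have "b (?w x z) = 0" if x: "x \<in> C" for x
    proof (rule b(3))
      have "r x > 0" "dist x z > r x" using x z C r by auto
      then show "1 \<le> norm (?w x z)" unfolding w[OF x] by (simp add: field_simps)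
    qed
    then show "P z = 1" unfolding P_def by simp
  qed
qed

lemma ex_compact_nhd:
  fixes K U :: "complex set"
  assumes "compact K" "open U" "K \<subseteq> U"
  obtains S V where "compact S" "S \<subseteq> U" "open V" "K \<subseteq> V" "V \<subseteq> S"
proof -
  obtain P :: "complex \<Rightarrow> complex" and S V where "compact S" "S \<subseteq> U" "open V" "K \<subseteq> V"
      "\<forall>z\<in>V. P z = 0" "\<forall>z. z \<notin> S \<longrightarrow> P z = 1"
    using ex_smooth_cutoff[OF assms] by blast
  \<comment> \<open>A point of \<open>V\<close> outside \<open>S\<close> would give \<open>P\<close>
    both values 0 and 1.\<close>
  moreover from this have "V \<subseteq> S" by force
  ultimately show thesis by (intro that)
qed

text \<open>Take \<psi> = 1 - P, where P(z) is the product of all P0(q^n z). It vanishes as soon as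
  one q^n z is near \<open>K\<close>, and is 1 unless some q^n z lies in \<open>S\<close>. Replacing
  z by q z drops only the factor P0(z), which is 1 near 0, so \<open>P\<close> is invariant there
  and its estimates come from one annulus by dilation.\<close>

lemma ex_invariant_cutoff:
  fixes K U :: "complex set"
  assumes q: "norm q > 1" and "open U" "0 \<notin> U" "compact K" "K \<subseteq> U"
  shows "\<exists>\<psi> S V \<rho>. compact S \<and> S \<subseteq> U \<and> (\<forall>z. \<psi> z \<noteq> (0::complex) \<longrightarrow> z \<in> q_orbit q S) \<and>
    open V \<and> q_orbit q K \<subseteq> V \<and> (\<forall>z\<in>V. \<psi> z = 1) \<and> (\<forall>k. Ck_on k (UNIV - {0}) \<psi>) \<and>
    \<rho> > 0 \<and> (\<forall>k. \<exists>C\<ge>0. symbol_bound k 0 C (ball 0 \<rho> - {0}) \<psi>)"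
proof -
  have q0: "q \<noteq> 0" using q by auto
  obtain P0 S V0 where *: "\<forall>k. Ck_on k UNIV P0" and S: "compact S" "S \<subseteq> U" and V: "open V0" "K \<subseteq> V0"
    and **: "\<forall>z\<in>V0. P0 z = (0::complex)" "\<forall>z. z \<notin> S \<longrightarrow> P0 z = 1"
    using ex_smooth_cutoff[OF assms(4,2,5)] by (elim exE conjE)
  note P0 = *[rule_format] and V0 = V **(1)[rule_format] and P01 = **(2)[rule_format]
  \<comment> \<open>For z different from 0, q^n z leaves the bounded set \<open>S\<close>, so all
    but finitely many factors are 1.\<close>
  define P where "P z = (\<Prod>n | P0 (q ^ n * z) \<noteq> 1. P0 (q ^ n * z))" for z
  have P_eq: "\<exists>N. \<forall>M\<ge>N. \<forall>z. norm z \<ge> s \<longrightarrow> P z = (\<Prod>n<M. P0 (q ^ n * z))" if "s > 0" for s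
  proof -
    obtain N where N: "\<And>n z. n \<ge> N \<Longrightarrow> norm z \<ge> s \<Longrightarrow> q ^ n * z \<notin> S"
      using q_power_escapes[OF q compact_imp_bounded[OF S(1)] \<open>s > 0\<close>] by blast
    have "P z = (\<Prod>n<M. P0 (q ^ n * z))" if M: "M \<ge> N" "norm z \<ge> s" for M z
      unfolding P_def
    proof (rule prod.mono_neutral_left)
      show "{n. P0 (q ^ n * z) \<noteq> 1} \<subseteq> {..<M}"
      proof
        fix n assume "n \<in> {n. P0 (q ^ n * z) \<noteq> 1}"
        then have "\<not> N \<le> n" using N[OF _ M(2), of n] P01 by auto
        then show "n \<in> {..<M}" using M(1) by simp
      qed
    qed auto
    then show ?thesis by blast
  qed
  have "open (- S)" "0 \<in> - S" using S assms(3) by (auto intro: compact_imp_closed)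
  then obtain \<rho> where \<rho>: "\<rho> > 0" "ball 0 \<rho> \<subseteq> - S" by (meson open_contains_ball)
  have P_q: "P z = P (q * z)" if z: "z \<noteq> 0" "norm z < \<rho>" for z
  proof -
    obtain M where M: "\<And>M' w. M' \<ge> M \<Longrightarrow> norm w \<ge> norm z \<Longrightarrow> P w = (\<Prod>n<M'. P0 (q ^ n * w))"
      using P_eq[of "norm z"] z(1) by auto
    have "norm z \<le> norm (q * z)"
      using q by (simp add: norm_mult mult_le_cancel_right1)
    then have "P (q * z) = (\<Prod>n<M. P0 (q ^ n * (q * z)))" by (intro M) auto
    also have "\<dots> = (\<Prod>n<M. P0 (q ^ Suc n * z))" by (simp add: ac_simps)
    also have "\<dots> = P0 z * \<dots>"
      using \<rho>(2) z(2) P01 by auto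
    also have "\<dots> = (\<Prod>n<Suc M. P0 (q ^ n * z))"
      by (simp only: prod.lessThan_Suc_shift power_0 mult_1)
    also have "\<dots> = P z" by (rule M[symmetric]) auto
    finally show ?thesis by simp
  qed
  \<comment> \<open>The range extends to |q| \<rho> because the last multiplication by
    \<open>q\<close> may start anywhere in the disc of radius \<rho>.\<close>
  have P_qn: "P z = P (q ^ n * z)" if z: "z \<noteq> 0" "norm (q ^ n * z) < norm q * \<rho>" for z n
    using z(2)
  proof (induction n)
    case (Suc n)
    have "norm q * norm (q ^ n * z) < norm q * \<rho>" using Suc.prems by (simp add: norm_mult ac_simps)
    then have *: "norm (q ^ n * z) < \<rho>" by (rule mult_left_less_imp_less) simp
    have "P (q ^ n * z) = P (q * (q ^ n * z))" using * z(1) q0 by (intro P_q) auto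
    moreover have "\<rho> < norm q * \<rho>" using q \<rho>(1) by simp
    ultimately show ?case using Suc.IH * by (simp add: ac_simps)
  qed simp
  have P_Ck: "Ck_on k (UNIV - {0}) P" for k
  proof (rule Ck_on_locally)
    fix z :: complex assume "z \<in> UNIV - {0}"
    then have s: "norm z / 2 > 0" by simp
    obtain N where N: "\<And>w. norm w \<ge> norm z / 2 \<Longrightarrow> P w = (\<Prod>n<N. P0 (q ^ n * w))"
      using P_eq[OF s] by blast
    have op: "open {w::complex. norm w > norm z / 2}"
      by (intro open_Collect_less continuous_intros)
    have "Ck_on k {w. norm w > norm z / 2} P"
    proof (rule Ck_on_cong[OF op])
      have "Ck_on k {w. norm w > norm z / 2} (\<lambda>w. P0 (q ^ n * w + 0))" for n
        by (rule Ck_on_affine[OF P0 op]) auto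
      then show "Ck_on k {w. norm w > norm z / 2} (\<lambda>w. \<Prod>n<N. P0 (q ^ n * w))"
        by (intro Ck_on_prod op) simp
    qed (use N in auto)
    then show "\<exists>W. open W \<and> z \<in> W \<and> Ck_on k W P"
      using s by (intro exI[of _ "{w. norm w > norm z / 2}"] conjI op) auto
  qed
  have P_bound: "\<exists>C\<ge>0. symbol_bound k 0 C (ball 0 \<rho> - {0}) P" for k
  proof -
    \<comment> \<open>The radii of this annulus have ratio 4 |q|, more than one step of the
      dilation, so the forward orbit of each point of the punctured disc meets it.\<close>
    define W where "W = {w::complex. \<rho> / 4 < norm w \<and> norm w < norm q * \<rho>}"
    define A where "A = cball 0 (norm q * \<rho>) - ball (0::complex) (\<rho> / 4)"
    have W: "open W" unfolding W_def
      by (intro open_Collect_conj open_Collect_less continuous_intros)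
    have "compact A" unfolding A_def by (intro compact_diff) auto
    moreover have "0 \<notin> A" "W \<subseteq> A" using \<rho>(1) by (auto simp: A_def W_def)
    ultimately obtain C where C: "C \<ge> 0" "symbol_bound k 0 C W P"
      using Ck_on_imp_symbol_bound[OF _ _ _ _ W _ P_Ck, of A k 0] by (auto simp: open_delete)
    have "symbol_bound k 0 C (ball 0 \<rho> - {0}) P"
    proof (rule symbol_bound_Union)
      fix z :: complex assume z: "z \<in> ball 0 \<rho> - {0}"
      obtain n where n: "q ^ n * z \<in> W"
      proof -
        obtain N where N: "\<rho> / 4 / norm z < norm q ^ N"
          using real_arch_pow[OF q] by blast
        then have "\<rho> / 4 < norm (q ^ N * z)" using z by (simp add: norm_mult norm_power field_simps)
        \<comment> \<open>The first iterate beyond \<rho>/4 is either z itself, of norm below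
          \<rho>, or at most |q| \<rho>/4, being one step past an iterate inside.\<close>
        then have L: "\<rho> / 4 < norm (q ^ (LEAST N. \<rho> / 4 < norm (q ^ N * z)) * z)" by (rule LeastI)
        define n where "n = (LEAST N. \<rho> / 4 < norm (q ^ N * z))"
        have "norm (q ^ n * z) < norm q * \<rho>"
        proof (cases n)
          case 0
          have "\<rho> < norm q * \<rho>" using q \<rho>(1) by simp
          then show ?thesis using 0 z by simp
        next
          case (Suc m)
          then have "\<not> \<rho> / 4 < norm (q ^ m * z)" unfolding n_def by (metis lessI not_less_Least)
          then have "norm q * norm (q ^ m * z) \<le> norm q * (\<rho> / 4)" by (intro mult_left_mono) auto
          also have "\<dots> < norm q * \<rho>" using q \<rho>(1) by (intro mult_strict_left_mono) auto
          finally show ?thesis using Suc by (simp add: norm_mult ac_simps)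
        qed
        then show thesis using L that[of n] by (simp add: W_def n_def)
      qed
      have sb: "symbol_bound k 0 C {w. q ^ n * w \<in> W} (\<lambda>w. P (q ^ n * w))"
        using symbol_bound_scale[OF W C(2), of "q ^ n"] q0 by simp
      have op: "open {w. q ^ n * w \<in> W}"
        using open_vimage[OF W, of "\<lambda>w. q ^ n * w"] by (simp add: vimage_def continuous_intros)
      have eq: "P (q ^ n * w) = P w" if "w \<in> {w. q ^ n * w \<in> W}" for w
      proof (rule P_qn[symmetric])
        show "w \<noteq> 0" using that \<rho>(1) by (auto simp: W_def)
        show "norm (q ^ n * w) < norm q * \<rho>" using that by (auto simp: W_def)
      qed
      have "symbol_bound k 0 C {w. q ^ n * w \<in> W} P"
        by (rule symbol_bound_cong[OF op order.refl eq sb])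
      then show "\<exists>W. z \<in> W \<and> symbol_bound k 0 C W P"
        using n by (intro exI[of _ "{w. q ^ n * w \<in> W}"]) simp
    qed
    then show ?thesis using C(1) by blast
  qed
  show ?thesis
  proof (rule exI[of _ "\<lambda>z. 1 - P z"], rule exI[of _ S], rule exI[of _ "q_orbit q V0 - {0}"],
      rule exI[of _ \<rho>], intro conjI allI ballI impI)
    fix z assume "1 - P z \<noteq> 0"
    then have "{n. P0 (q ^ n * z) \<noteq> 1} \<noteq> {}" unfolding P_def by force
    then obtain n where "P0 (q ^ n * z) \<noteq> 1" by blast
    then have "q ^ n * z \<in> S" using P01 by blast
    then show "z \<in> q_orbit q S" unfolding q_orbit_iff[OF q0] by blast
  next
    show "open (q_orbit q V0 - {0})" by (intro open_delete open_q_orbit q0 V0)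
    have "0 \<notin> q_orbit q K" using assms q_orbit_iff[OF q0, of 0 K] by auto
    then show "q_orbit q K \<subseteq> q_orbit q V0 - {0}" using q_orbit_mono[OF V0(2), of q] by auto
  next
    fix z assume z: "z \<in> q_orbit q V0 - {0}"
    then obtain n where n: "q ^ n * z \<in> V0" by (auto simp: q_orbit_iff[OF q0])
    obtain N where N: "\<And>M. M \<ge> N \<Longrightarrow> P z = (\<Prod>n<M. P0 (q ^ n * z))"
      using P_eq[of "norm z"] z by auto
    have "P z = (\<Prod>n<N + Suc n. P0 (q ^ n * z))" by (rule N) simp
    also have "\<dots> = 0" using V0(3)[OF n] by (intro prod_zero bexI[of _ n]) auto
    finally show "1 - P z = 1" by simp
  next
    fix k
    show "Ck_on k (UNIV - {0}) (\<lambda>z. 1 - P z)"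
      by (intro Ck_on_diff Ck_on_const P_Ck open_delete open_UNIV)
    obtain C where C: "C \<ge> 0" "symbol_bound k 0 C (ball 0 \<rho> - {0}) P" using P_bound by blast
    have "symbol_bound k 0 (norm (1::complex) + C * norm (- 1::complex)) (ball 0 \<rho> - {0}) (\<lambda>z. 1 + - 1 * P z)"
      by (intro symbol_bound_add symbol_bound_const symbol_bound_cmult C open_delete open_ball)
    then show "\<exists>C\<ge>0. symbol_bound k 0 C (ball 0 \<rho> - {0}) (\<lambda>z. 1 - P z)"
      using C(1) by (intro exI[of _ "1 + C"]) simp
  qed (use S \<rho> in auto)
qed

section \<open>Cauchy estimates on invariant sets\<close>

lemma power_int_comparable:
  fixes x y :: real
  assumes "0 < x" "0 < y" "y \<le> 2 * x" "x \<le> 2 * y"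
  shows "y powi m \<le> 2 powi \<bar>m\<bar> * x powi m"
proof (cases "m \<ge> 0")
  case True
  have "y powi m \<le> (2 * x) powi m" using True assms by (intro power_int_mono) auto
  then show ?thesis using True by (simp add: power_int_mult_distrib)
next
  case False
  have "x powi (- m) \<le> (2 * y) powi (- m)" using False assms by (intro power_int_mono) auto
  then have "x powi (- m) \<le> 2 powi (- m) * y powi (- m)" by (simp add: power_int_mult_distrib)
  then show ?thesis using False assms by (simp add: power_int_minus field_simps)
qed

text \<open>Apply Cauchy's inequality on a circle of radius c |z|: dividing by this radius costs
  exactly one power of |z|. Multiplication by q^n brings z into \<open>A\<close> and the circle into
  a fixed neighbourhood of \<open>A\<close>, so one \<open>c\<close> serves the whole orbit. The
  circle leaves the orbit of \<open>A\<close>, which is why decay is assumed for every compact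
  subset of \<open>U\<close>.\<close>

lemma orbit_decay_deriv:
  assumes q: "norm q > 1" and U: "open U" "0 \<notin> U" "(\<lambda>z. inverse q * z) ` U \<subseteq> U"
    and f: "f holomorphic_on U"
    and decay: "\<And>A. compact A \<Longrightarrow> A \<subseteq> U \<Longrightarrow> \<exists>C. \<forall>z\<in>q_orbit q A. norm (f z) \<le> C * norm z powi m"
    and A: "compact A" "A \<subseteq> U"
  shows "\<exists>C. \<forall>z\<in>q_orbit q A. norm (deriv f z) \<le> C * norm z powi (m - 1)"
proof -
  have q0: "q \<noteq> 0" using q by auto
  obtain S V where S: "compact S" "S \<subseteq> U" and V: "open V" "A \<subseteq> V" "V \<subseteq> S"
    by (rule ex_compact_nhd[OF A(1) U(1) A(2)])
  obtain \<delta> where \<delta>: "\<delta> > 0" "(\<Union>x\<in>A. cball x \<delta>) \<subseteq> V"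
    using compact_subset_open_imp_cball_epsilon_subset[OF A(1) V(1,2)] by blast
  obtain R where R: "R > 0" "\<And>x. x \<in> A \<Longrightarrow> norm x \<le> R"
    using compact_imp_bounded[OF A(1)] unfolding bounded_pos by blast
  obtain C where C: "\<And>z. z \<in> q_orbit q S \<Longrightarrow> norm (f z) \<le> C * norm z powi m"
    using decay[OF S] by blast
  \<comment> \<open>The bound \<delta>/R keeps the dilated disc within \<delta> of \<open>A\<close>,
    hence in \<open>S\<close>; the bound 1/2 keeps |y| and |z| within a factor 2 on the
    circle.\<close>
  define c where "c = min (\<delta> / R) (1/2)"
  have c: "c > 0" "c \<le> 1/2" "c * R \<le> \<delta>" using \<delta>(1) R(1) by (auto simp: c_def min_def field_simps)
  have "norm (deriv f z) \<le> (\<bar>C\<bar> * 2 powi \<bar>m\<bar> / c) * norm z powi (m - 1)" if z: "z \<in> q_orbit q A" for z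
  proof -
    have z0: "z \<noteq> 0" using z q_orbit_subset[OF U(3) A(2)] U(2) by blast
    obtain n where n: "q ^ n * z \<in> A" using z unfolding q_orbit_iff[OF q0] by blast
    have sub: "y \<in> q_orbit q S" if y: "norm (z - y) \<le> c * norm z" for y
    proof -
      have "dist (q ^ n * z) (q ^ n * y) = norm (q ^ n) * norm (z - y)"
        by (simp add: dist_norm norm_mult[symmetric] algebra_simps)
      also have "\<dots> \<le> norm (q ^ n) * (c * norm z)" using y by (intro mult_left_mono) auto
      also have "\<dots> = c * norm (q ^ n * z)" by (simp add: norm_mult)
      also have "\<dots> \<le> c * R" using R(2)[OF n] c by (intro mult_left_mono) auto
      also have "\<dots> \<le> \<delta>" by (rule c)
      finally have "q ^ n * y \<in> cball (q ^ n * z) \<delta>" by simp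
      then have "q ^ n * y \<in> S" using n \<delta>(2) V(3) by blast
      then show ?thesis unfolding q_orbit_iff[OF q0] by blast
    qed
    have cb: "cball z (c * norm z) \<subseteq> U"
      using sub q_orbit_subset[OF U(3) S(2)] by (auto simp: dist_norm)
    have "norm ((deriv ^^ 1) f z) \<le> fact 1 * (\<bar>C\<bar> * (2 powi \<bar>m\<bar> * norm z powi m)) / (c * norm z) ^ 1"
    proof (rule Cauchy_inequality)
      show "f holomorphic_on ball z (c * norm z)"
        using f cb ball_subset_cball holomorphic_on_subset by blast
      show "continuous_on (cball z (c * norm z)) f"
        using f cb holomorphic_on_imp_continuous_on holomorphic_on_subset by blast
      show "0 < c * norm z" using c z0 by simp
      fix y assume y: "norm (z - y) = c * norm z"
      have le: "c * norm z \<le> norm z / 2" using mult_right_mono[OF c(2), of "norm z"] by simp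
      have tri: "norm z \<le> norm y + norm (z - y)" "norm y \<le> norm z + norm (z - y)"
        using norm_triangle_sub[of z y] norm_triangle_sub[of y z] by (auto simp: norm_minus_commute)
      have nz: "norm z > 0" using z0 by simp
      have "norm (f y) \<le> C * norm y powi m" using sub[of y] y by (intro C) simp
      also have "\<dots> \<le> \<bar>C\<bar> * norm y powi m" by (intro mult_right_mono) auto
      also have "\<dots> \<le> \<bar>C\<bar> * (2 powi \<bar>m\<bar> * norm z powi m)"
        using le tri y nz by (intro mult_left_mono power_int_comparable) linarith+
      finally show "norm (f y) \<le> \<bar>C\<bar> * (2 powi \<bar>m\<bar> * norm z powi m)" .
    qed
    then show ?thesis using z0 by (simp add: power_int_diff field_simps)
  qed
  then show ?thesis by blast
qed

text \<open>The decay hypothesis, with \<open>m - 1\<close> for \<open>m\<close>, holds again for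
  \<open>deriv f\<close> by \<open>orbit_decay_deriv\<close>, so the induction on \<open>k\<close>
  can be run on \<open>f\<close> itself.\<close>

lemma orbit_decay_imp_symbol_bound:
  assumes q: "norm q > 1" and U: "open U" "0 \<notin> U" "(\<lambda>z. inverse q * z) ` U \<subseteq> U"
    and f: "f holomorphic_on U"
    and decay: "\<And>A. compact A \<Longrightarrow> A \<subseteq> U \<Longrightarrow> \<exists>C. \<forall>z\<in>q_orbit q A. norm (f z) \<le> C * norm z powi m"
    and A: "compact A" "A \<subseteq> U" and W: "open W" "W \<subseteq> q_orbit q A"
  shows "\<exists>C\<ge>0. symbol_bound k m C W f"
  using f decay
proof (induction k arbitrary: m f)
  case (0 m f)
  obtain C where C: "\<And>z. z \<in> q_orbit q A \<Longrightarrow> norm (f z) \<le> C * norm z powi m"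
    using 0(2)[OF A] by blast
  have "norm (f z) \<le> \<bar>C\<bar> * norm z powi m" if "z \<in> W" for z
    using C[of z] W(2) that mult_right_mono[of C "\<bar>C\<bar>" "norm z powi m"] by force
  moreover have "isCont f z" if "z \<in> W" for z
    using that W(2) q_orbit_subset[OF U(3) A(2)] 0(1) U(1)
    by (meson continuous_on_eq_continuous_at holomorphic_on_imp_continuous_on subsetD)
  ultimately show ?case by (intro exI[of _ "\<bar>C\<bar>"]) auto
next
  case (Suc k m f)
  have WU: "W \<subseteq> U" using W(2) q_orbit_subset[OF U(3) A(2)] by blast
  obtain C where C: "\<And>z. z \<in> q_orbit q A \<Longrightarrow> norm (f z) \<le> C * norm z powi m"
    using Suc.prems(2)[OF A] by blast
  have "\<exists>C\<ge>0. symbol_bound k (m - 1) C W (deriv f)"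
    by (intro Suc.IH holomorphic_deriv Suc.prems(1) U(1) orbit_decay_deriv[OF q U] Suc.prems(2))
  then obtain D where D: "D \<ge> 0" "symbol_bound k (m - 1) D W (deriv f)" by blast
  have "symbol_bound (Suc k) m (\<bar>C\<bar> + D) W f"
  proof (rule symbol_bound_SucI[OF W(1) order.refl])
    fix z assume z: "z \<in> W"
    show "(f has_derivative (\<lambda>v. deriv f z * v)) (at z)"
      using holomorphic_derivI[OF Suc.prems(1) U(1) subsetD[OF WU z]]
      by (simp add: has_field_derivative_def)
    have "C * norm z powi m \<le> (\<bar>C\<bar> + D) * norm z powi m" using D by (intro mult_right_mono) auto
    then show "norm (f z) \<le> (\<bar>C\<bar> + D) * norm z powi m" using C[of z] z W(2) by fastforce
  next
    fix v
    have "symbol_bound k (m - 1) (D * norm v) W (\<lambda>z. v * deriv f z)"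
      by (rule symbol_bound_cmult[OF W(1) D(2)])
    then have "symbol_bound k (m - 1) ((\<bar>C\<bar> + D) * norm v) W (\<lambda>z. v * deriv f z)"
      by (rule symbol_bound_mono) (auto intro: mult_right_mono)
    then show "symbol_bound k (m - 1) ((\<bar>C\<bar> + D) * norm v) W (\<lambda>z. deriv f z * v)"
      by (simp add: mult.commute)
  qed
  then show ?case using D by (intro exI[of _ "\<bar>C\<bar> + D"]) auto
qed

section \<open>Taylor expansion of jets annihilated by \<open>\<partial>/\<partial>\<bar>z\<close>\<close>

lemma line_segment_bound:
  assumes "\<And>t. t \<in> {0..1} \<Longrightarrow> g differentiable (at (a + t *\<^sub>R v))"
    "\<And>t. t \<in> {0..1} \<Longrightarrow> norm (frechet_derivative g (at (a + t *\<^sub>R v)) v) \<le> B"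
  shows "norm (g (a + v) - g a) \<le> B"
proof -
  have "norm (g (a + 1 *\<^sub>R v) - g (a + 0 *\<^sub>R v)) \<le> B * norm (1 - 0 :: real)"
  proof (rule differentiable_bound[where S = "{0..1}"])
    fix t :: real assume t: "t \<in> {0..1}"
    let ?D = "frechet_derivative g (at (a + t *\<^sub>R v))"
    have D: "(g has_derivative ?D) (at (a + t *\<^sub>R v))"
      using assms(1)[OF t] frechet_derivative_works by blast
    have "((\<lambda>t. a + t *\<^sub>R v) has_derivative (\<lambda>s. s *\<^sub>R v)) (at t within {0..1})"
      by (auto intro!: derivative_eq_intros)
    from has_derivative_compose[OF this D]
    show "((\<lambda>t. g (a + t *\<^sub>R v)) has_derivative (\<lambda>s. ?D (s *\<^sub>R v))) (at t within {0..1})" .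
    show "onorm (\<lambda>s. ?D (s *\<^sub>R v)) \<le> B"
    proof (rule onorm_le)
      fix s :: real
      have "?D (s *\<^sub>R v) = s *\<^sub>R ?D v"
        using linear_frechet_derivative[OF assms(1)[OF t]] by (rule linear_scale)
      then show "norm (?D (s *\<^sub>R v)) \<le> B * norm s"
        using mult_left_mono[OF assms(2)[OF t], of "\<bar>s\<bar>"] by (simp add: mult.commute)
    qed
  qed auto
  then show ?thesis by simp
qed

lemma Ck_on_imp_frechet_eq:
  assumes "Ck_on (Suc n) V g" "z \<in> V"
  shows "frechet_derivative g (at z) v = of_real (Re v) * partial_x g z + of_real (Im v) * partial_y g z"
  using frechet_derivative_complex_eq[of g z v] assms by (simp add: partial_x_def partial_y_def)

lemma Ck_on_locally_bounded:
  assumes "open V" "0 \<in> V" "Ck_on n V g"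
  shows "\<exists>\<epsilon>>0. \<exists>C. \<forall>z\<in>ball 0 \<epsilon>. norm (g z) \<le> C"
proof -
  have "continuous_on V g" using Ck_on_le[OF assms(3), of 0] by simp
  then have "isCont g 0" using assms continuous_on_eq_continuous_at by blast
  then obtain d where d: "d > 0" "\<And>z. dist z 0 < d \<Longrightarrow> dist (g z) (g 0) < 1"
    unfolding continuous_at_eps_delta by (metis zero_less_one)
  have "norm (g z) \<le> norm (g 0) + 1" if "z \<in> ball 0 d" for z
  proof -
    have "norm (g z - g 0) < 1" using d(2)[of z] that by (simp add: dist_norm)
    then show ?thesis using norm_triangle_sub[of "g z" "g 0"] by linarith
  qed
  then show ?thesis using d(1) by blast
qed

text \<open>This treats the first leg of the path from 0 to z, along the real axis and then
  vertically. On this leg only pure x-derivatives enter.\<close>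

lemma real_axis_flat:
  assumes "open V" "0 \<in> V" "Ck_on n V g" "\<And>i. i < n \<Longrightarrow> partial_deriv (i, 0) g 0 = 0"
  shows "\<exists>\<epsilon>>0. \<exists>C. \<forall>x. \<bar>x\<bar> < \<epsilon> \<longrightarrow> norm (g (of_real x)) \<le> C * \<bar>x\<bar> ^ n"
  using assms(3,4)
proof (induction n arbitrary: g)
  case 0
  obtain \<epsilon> C where "\<epsilon> > 0" "\<And>z. z \<in> ball 0 \<epsilon> \<Longrightarrow> norm (g z) \<le> C"
    using Ck_on_locally_bounded[OF assms(1,2) 0(1)] by blast
  then show ?case by (intro exI[of _ \<epsilon>] conjI exI[of _ C]) auto
next
  case (Suc n)
  have "\<exists>\<epsilon>>0. \<exists>C. \<forall>x. \<bar>x\<bar> < \<epsilon> \<longrightarrow> norm (partial_x g (of_real x)) \<le> C * \<bar>x\<bar> ^ n"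
  proof (rule Suc.IH)
    show "Ck_on n V (partial_x g)" using Suc.prems(1) by (rule Ck_on_partial_x)
    show "partial_deriv (i, 0) (partial_x g) 0 = 0" if "i < n" for i
      using Suc.prems(2)[of "Suc i"] that by (simp add: partial_deriv_Suc_0)
  qed
  then obtain \<epsilon> C where \<epsilon>: "\<epsilon> > 0" "\<And>x. \<bar>x\<bar> < \<epsilon> \<Longrightarrow> norm (partial_x g (of_real x)) \<le> C * \<bar>x\<bar> ^ n"
    by blast
  obtain r where r: "r > 0" "ball 0 r \<subseteq> V" using assms(1,2) open_contains_ball by blast
  have "norm (g (of_real x)) \<le> \<bar>C\<bar> * \<bar>x\<bar> ^ Suc n" if x: "\<bar>x\<bar> < min \<epsilon> r" for x
  proof -
    have tx: "\<bar>t * x\<bar> \<le> \<bar>x\<bar>" if "t \<in> {0..1}" for t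
      using that by (simp add: abs_mult mult_left_le_one_le)
    have V: "0 + t *\<^sub>R complex_of_real x \<in> V" if "t \<in> {0..1}" for t
    proof -
      have "norm (0 + t *\<^sub>R complex_of_real x) < r" using tx[OF that] x by (simp add: abs_mult)
      then show ?thesis using r(2) by auto
    qed
    have "norm (g (0 + of_real x) - g 0) \<le> \<bar>C\<bar> * \<bar>x\<bar> ^ Suc n"
    proof (rule line_segment_bound)
      fix t :: real assume t: "t \<in> {0..1}"
      show "g differentiable at (0 + t *\<^sub>R complex_of_real x)"
        using Suc.prems(1) V[OF t] by simp
      have "frechet_derivative g (at (0 + t *\<^sub>R complex_of_real x)) (of_real x) =
          of_real x * partial_x g (of_real (t * x))"
        using Ck_on_imp_frechet_eq[OF Suc.prems(1) V[OF t]] by (simp add: scaleR_conv_of_real)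
      moreover have "norm (partial_x g (of_real (t * x))) \<le> \<bar>C\<bar> * \<bar>x\<bar> ^ n"
      proof -
        have "norm (partial_x g (of_real (t * x))) \<le> C * \<bar>t * x\<bar> ^ n"
          using tx[OF t] x by (intro \<epsilon>(2)) auto
        also have "\<dots> \<le> \<bar>C\<bar> * \<bar>x\<bar> ^ n" using tx[OF t] by (intro mult_mono power_mono) auto
        finally show ?thesis .
      qed
      then have "\<bar>x\<bar> * norm (partial_x g (of_real (t * x))) \<le> \<bar>x\<bar> * (\<bar>C\<bar> * \<bar>x\<bar> ^ n)"
        by (intro mult_left_mono) auto
      ultimately show "norm (frechet_derivative g (at (0 + t *\<^sub>R complex_of_real x)) (of_real x)) \<le> \<bar>C\<bar> * \<bar>x\<bar> ^ Suc n"
        by (simp add: norm_mult ac_simps)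
    qed
    moreover have "g 0 = 0" using Suc.prems(2)[of 0] by simp
    ultimately show ?thesis by simp
  qed
  then show ?case using \<epsilon>(1) r(1) by (intro exI[of _ "min \<epsilon> r"] conjI exI[of _ "\<bar>C\<bar>"]) auto
qed

text \<open>Integrating \<open>\<partial>\<^sub>y g\<close> from the real axis uses each mixed derivative in only one order, so the
  symmetry of higher derivatives is not required.\<close>

lemma flat_jet_bound:
  assumes "open V" "0 \<in> V" "Ck_on n V g" "\<And>i j. i + j < n \<Longrightarrow> partial_deriv (i, j) g 0 = 0"
  shows "\<exists>\<epsilon>>0. \<exists>C. \<forall>z\<in>ball 0 \<epsilon>. norm (g z) \<le> C * norm z ^ n"
  using assms(3,4)
proof (induction n arbitrary: g)
  case 0
  then show ?case using Ck_on_locally_bounded[OF assms(1,2) 0(1)] by simp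
next
  case (Suc n)
  have "\<exists>\<epsilon>>0. \<exists>C. \<forall>z\<in>ball 0 \<epsilon>. norm (partial_y g z) \<le> C * norm z ^ n"
  proof (rule Suc.IH)
    show "Ck_on n V (partial_y g)" using Suc.prems(1) by (rule Ck_on_partial_y)
    show "partial_deriv (i, j) (partial_y g) 0 = 0" if "i + j < n" for i j
      using Suc.prems(2)[of i "Suc j"] that by (simp add: partial_deriv_Suc_right)
  qed
  then obtain \<epsilon> C where \<epsilon>: "\<epsilon> > 0" "\<And>z. z \<in> ball 0 \<epsilon> \<Longrightarrow> norm (partial_y g z) \<le> C * norm z ^ n"
    by blast
  obtain \<epsilon>' C' where \<epsilon>': "\<epsilon>' > 0" "\<And>x. \<bar>x\<bar> < \<epsilon>' \<Longrightarrow> norm (g (of_real x)) \<le> C' * \<bar>x\<bar> ^ Suc n"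
    using real_axis_flat[OF assms(1,2) Suc.prems(1)] Suc.prems(2) by auto
  obtain r where r: "r > 0" "ball 0 r \<subseteq> V" using assms(1,2) open_contains_ball by blast
  define s where "s = min \<epsilon> (min \<epsilon>' r)"
  have "norm (g z) \<le> (\<bar>C\<bar> + \<bar>C'\<bar>) * norm z ^ Suc n" if "z \<in> ball 0 s" for z
  proof -
    define x y where "x = Re z" and "y = Im z"
    have z: "norm z < s" "\<bar>x\<bar> \<le> norm z" "\<bar>y\<bar> \<le> norm z" "of_real x + \<i> * of_real y = z"
      using that by (auto simp: x_def y_def abs_Re_le_cmod abs_Im_le_cmod complex_eq_iff)
    let ?w = "\<lambda>t. complex_of_real x + t *\<^sub>R (\<i> * of_real y)"
    have w: "norm (?w t) \<le> norm z" if "t \<in> {0..1}" for t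
    proof -
      have "\<bar>t * y\<bar> \<le> \<bar>y\<bar>" using that by (simp add: abs_mult mult_left_le_one_le)
      then have "(t * y)\<^sup>2 \<le> y\<^sup>2" by (rule abs_le_square_iff[THEN iffD1])
      then show ?thesis by (simp add: cmod_def x_def y_def)
    qed
    have V: "?w t \<in> V" if "t \<in> {0..1}" for t
    proof -
      have "norm (?w t) < r" using w[OF that] z(1) by (simp add: s_def)
      then show ?thesis using r(2) by auto
    qed
    have "norm (g (of_real x + \<i> * of_real y) - g (of_real x)) \<le> \<bar>C\<bar> * norm z ^ Suc n"
    proof (rule line_segment_bound)
      fix t :: real assume t: "t \<in> {0..1}"
      show "g differentiable at (?w t)"
        using Suc.prems(1) V[OF t] by simp
      have "frechet_derivative g (at (?w t)) (\<i> * of_real y) = of_real y * partial_y g (?w t)"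
        using Ck_on_imp_frechet_eq[OF Suc.prems(1) V[OF t]] by simp
      then have eq: "norm (frechet_derivative g (at (?w t)) (\<i> * of_real y)) = \<bar>y\<bar> * norm (partial_y g (?w t))"
        by (simp only: norm_mult norm_of_real)
      have "norm (partial_y g (?w t)) \<le> C * norm (?w t) ^ n"
        using w[OF t] z(1) by (intro \<epsilon>(2)) (simp add: s_def)
      also have "\<dots> \<le> \<bar>C\<bar> * norm z ^ n" using w[OF t] by (intro mult_mono power_mono) auto
      finally have "\<bar>y\<bar> * norm (partial_y g (?w t)) \<le> norm z * (\<bar>C\<bar> * norm z ^ n)"
        using z(3) by (intro mult_mono) auto
      then show "norm (frechet_derivative g (at (?w t)) (\<i> * of_real y)) \<le> \<bar>C\<bar> * norm z ^ Suc n"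
        unfolding eq by (simp add: ac_simps)
    qed
    moreover have "norm (g (of_real x)) \<le> \<bar>C'\<bar> * norm z ^ Suc n"
    proof -
      have "norm (g (of_real x)) \<le> C' * \<bar>x\<bar> ^ Suc n" using z(1,2) by (intro \<epsilon>'(2)) (simp add: s_def)
      also have "\<dots> \<le> \<bar>C'\<bar> * norm z ^ Suc n" using z(2) by (intro mult_mono power_mono) auto
      finally show ?thesis .
    qed
    ultimately show ?thesis
      using norm_triangle_sub[of "g z" "g (of_real x)"] z(4) by (simp add: distrib_right)
  qed
  then show ?case using \<epsilon>(1) \<epsilon>'(1) r(1) by (intro exI[of _ s] conjI exI[of _ "\<bar>C\<bar> + \<bar>C'\<bar>"]) (auto simp: s_def)
qed

section \<open>Jets annihilated by the Cauchy-Riemann operator\<close>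

lemma higher_deriv_polynomial_at_0:
  fixes c :: "nat \<Rightarrow> complex"
  shows "(deriv ^^ m) (\<lambda>z. \<Sum>p<n. c p * z ^ p) 0 = (if m < n then fact m * c m else 0)"
proof (induction m arbitrary: c n)
  case 0
  have "(\<Sum>p<n. c p * 0 ^ p) = (\<Sum>p<n. if p = 0 then c 0 else 0)"
    by (intro sum.cong) auto
  then show ?case by (simp add: sum.delta)
next
  case (Suc m)
  have "deriv (\<lambda>z. \<Sum>p<n. c p * z ^ p) = (\<lambda>z. \<Sum>p<n - 1. (of_nat (Suc p) * c (Suc p)) * z ^ p)"
  proof
    fix z
    have "((\<lambda>z. \<Sum>p<n. c p * z ^ p) has_field_derivative (\<Sum>p<n. c p * (of_nat p * z ^ (p - 1)))) (at z)"
      by (auto intro!: derivative_eq_intros simp: ac_simps)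
    then have "deriv (\<lambda>z. \<Sum>p<n. c p * z ^ p) z = (\<Sum>p<n. c p * (of_nat p * z ^ (p - 1)))"
      by (rule DERIV_imp_deriv)
    also have "\<dots> = (\<Sum>p<n - 1. (of_nat (Suc p) * c (Suc p)) * z ^ p)"
      by (cases n) (simp_all add: sum.lessThan_Suc_shift ac_simps del: sum.lessThan_Suc of_nat_Suc)
    finally show "deriv (\<lambda>z. \<Sum>p<n. c p * z ^ p) z = \<dots>" .
  qed
  then show ?case
    using Suc.IH[where n = "n - 1" and c = "\<lambda>p. of_nat (Suc p) * c (Suc p)"]
    by (auto simp: funpow_Suc_right algebra_simps simp del: funpow.simps)
qed

text \<open>A condition on the full jet at one point: it forces no holomorphy near that point, which
  matters at 0 and at boundary points of \<open>K\<close>.\<close>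

definition jet_dbar_flat :: "(complex \<Rightarrow> complex) \<Rightarrow> complex \<Rightarrow> bool" where
  "jet_dbar_flat g z \<longleftrightarrow>
    (\<forall>i j. partial_deriv (Suc i, j) g z + \<i> * partial_deriv (i, Suc j) g z = 0)"

lemma mem_ker_dbar_iff:
  "F \<in> ker_dbar L \<longleftrightarrow> (\<exists>V g. open V \<and> L \<subseteq> V \<and> smooth_on V g \<and> (\<forall>z\<in>L. jet_dbar_flat g z) \<and>
     F = (\<lambda>k z. if z \<in> L then partial_deriv k g z else 0))"
proof -
  have "dbar_jet (\<lambda>k z. if z \<in> L then partial_deriv k g z else 0) = (\<lambda>k z. 0) \<longleftrightarrow>
      (\<forall>z\<in>L. jet_dbar_flat g z)" for g
    by (auto simp: dbar_jet_def jet_dbar_flat_def fun_eq_iff)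
  then show ?thesis unfolding ker_dbar_def whitney_smooth_def by auto
qed

lemma jet_dbar_flat_holomorphic:
  assumes "open V" "f holomorphic_on V" "z \<in> V"
  shows "jet_dbar_flat f z"
  unfolding jet_dbar_flat_def partial_deriv_holomorphic[OF assms]
  by (simp del: funpow.simps flip: mult.assoc)

lemma jet_dbar_flat_cong:
  assumes "open V" "\<And>z. z \<in> V \<Longrightarrow> f z = g z" "z \<in> V" "jet_dbar_flat f z"
  shows "jet_dbar_flat g z"
  using assms(4) partial_deriv_cong[where f = f and g = g, OF assms(1-3)] unfolding jet_dbar_flat_def by simp

text \<open>Each y-derivative can be traded for \<i> times an x-derivative, leaving one free number
  per total order. These numbers become the Taylor coefficients.\<close>

lemma jet_dbar_flat_partial_deriv:
  assumes "jet_dbar_flat g z"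
  shows "partial_deriv (i, j) g z = \<i> ^ j * partial_deriv (i + j, 0) g z"
proof (induction j arbitrary: i)
  case (Suc j)
  have "partial_deriv (Suc i, j) g z + \<i> * partial_deriv (i, Suc j) g z = 0"
    using assms unfolding jet_dbar_flat_def by blast
  then have "\<i> * (partial_deriv (Suc i, j) g z + \<i> * partial_deriv (i, Suc j) g z) = 0" by simp
  then have "partial_deriv (i, Suc j) g z = \<i> * partial_deriv (Suc i, j) g z"
    by (simp add: algebra_simps)
  then show ?case using Suc.IH[of "Suc i"] by simp
qed simp

lemma jet_dbar_flat_has_field_derivative:
  assumes "g differentiable (at z)" "jet_dbar_flat g z"
  shows "(g has_field_derivative partial_x g z) (at z)"
proof -
  have *: "partial_y g z = \<i> * partial_x g z"
    using jet_dbar_flat_partial_deriv[OF assms(2), of 0 1] by (simp add: partial_deriv_def)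
  have "frechet_derivative g (at z) v = partial_x g z * v" for v
  proof -
    have "frechet_derivative g (at z) v = of_real (Re v) * partial_x g z + of_real (Im v) * partial_y g z"
      using frechet_derivative_complex_eq[OF assms(1), of v] by (simp add: partial_x_def partial_y_def)
    also have "\<dots> = partial_x g z * (of_real (Re v) + \<i> * of_real (Im v))"
      by (simp add: * algebra_simps)
    finally show ?thesis by (simp only: complex_eq[of v, symmetric])
  qed
  then have "frechet_derivative g (at z) = (*) (partial_x g z)" by auto
  then show ?thesis
    using assms(1) frechet_derivative_works[of g "at z"] by (simp add: has_field_derivative_def)
qed

text \<open>The polynomial is holomorphic, so its jet at 0 is also determined by pure x-derivatives,
  and the coefficients make these agree with those of \<open>g\<close> below order \<open>n\<close>.
  The difference therefore has vanishing jet below order \<open>n\<close>, and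
  \<open>flat_jet_bound\<close> applies.\<close>

lemma jet_dbar_flat_taylor:
  assumes "open V" "0 \<in> V" "smooth_on V g" "jet_dbar_flat g 0"
  shows "\<exists>\<epsilon>>0. \<exists>C. \<forall>z\<in>ball 0 \<epsilon>. norm (g z - (\<Sum>p<n. partial_deriv (p, 0) g 0 / fact p * z ^ p)) \<le> C * norm z ^ n"
proof (rule flat_jet_bound[OF assms(1,2)])
  define a where "a p = partial_deriv (p, 0) g 0 / fact p" for p
  define T where "T = (\<lambda>z. \<Sum>p<n. a p * z ^ p)"
  define e where "e = (\<lambda>z. g z - T z)"
  have Ck: "Ck_on k V g" for k using assms(3) by (simp add: smooth_on_def)
  have T: "T holomorphic_on UNIV" unfolding T_def by (intro holomorphic_intros)
  have CkT: "Ck_on k V T" for k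
    using Ck_on_mono[OF Ck_on_holomorphic[OF open_UNIV T]] by simp
  have Cke: "Ck_on k V e" for k unfolding e_def by (intro Ck_on_diff assms Ck CkT)
  show "Ck_on n V (\<lambda>z. g z - (\<Sum>p<n. partial_deriv (p, 0) g 0 / fact p * z ^ p))"
    using Cke[of n] by (simp add: e_def T_def a_def)
  fix i j assume ij: "i + j < n"
  have "partial_deriv (i, j) g 0 = partial_deriv (i, j) (\<lambda>z. T z + e z) 0"
    by (rule partial_deriv_cong[OF assms(1)]) (use assms in \<open>auto simp: e_def\<close>)
  also have "\<dots> = partial_deriv (i, j) T 0 + partial_deriv (i, j) e 0"
    by (rule partial_deriv_add[OF assms(1,2) CkT Cke])
  also have "partial_deriv (i, j) T 0 = \<i> ^ j * (fact (i + j) * a (i + j))"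
    using partial_deriv_holomorphic[OF open_UNIV T, of 0 i j] higher_deriv_polynomial_at_0[where m = "i + j" and n = n and c = a] ij
    by (simp add: T_def)
  also have "\<dots> = partial_deriv (i, j) g 0"
    using jet_dbar_flat_partial_deriv[OF assms(4), of i j] by (simp add: a_def)
  finally have "partial_deriv (i, j) e 0 = 0" by simp
  then show "partial_deriv (i, j) (\<lambda>z. g z - (\<Sum>p<n. partial_deriv (p, 0) g 0 / fact p * z ^ p)) 0 = 0"
    by (simp add: e_def T_def a_def)
qed

section \<open>Asymptotic expansions and Whitney jets\<close>

text \<open>Clears the quotient in the definition of the expansion. At 0 this would fail for
  positive \<open>n\<close>, because there \<open>inverse (z ^ n)\<close> is 0 and the bound says
  nothing about \<open>f\<close>.\<close>

lemma q_asymptotic_imp_orbit_decay: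
  assumes "has_q_asymptotic_expansion q U f a" "compact A" "A \<subseteq> U" "0 \<notin> q_orbit q A"
  shows "\<exists>C. \<forall>z\<in>q_orbit q A. norm (f z - (\<Sum>p<n. fps_nth a p * z ^ p)) \<le> C * norm z powi int n"
proof -
  have "invariant_strict_subset q U (q_orbit q A)"
    using assms(2,3) unfolding invariant_strict_subset_iff by blast
  then have "bounded ((\<lambda>z. inverse (z ^ n) * (f z - (\<Sum>p<n. fps_nth a p * z ^ p))) ` q_orbit q A)"
    using assms(1) unfolding has_q_asymptotic_expansion_def by blast
  then obtain C where C: "\<And>z. z \<in> q_orbit q A \<Longrightarrow> norm (inverse (z ^ n) * (f z - (\<Sum>p<n. fps_nth a p * z ^ p))) \<le> C"
    unfolding bounded_iff by blast
  have "norm (f z - (\<Sum>p<n. fps_nth a p * z ^ p)) \<le> C * norm z powi int n" if z: "z \<in> q_orbit q A" for z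
  proof -
    have "z \<noteq> 0" using z assms(4) by metis
    then have "norm z ^ n > 0" by simp
    then show ?thesis using C[OF z] by (simp add: norm_mult norm_inverse norm_divide norm_power field_simps)
  qed
  then show ?thesis by blast
qed

lemma q_asymptotic_imp_jets:
  assumes q: "norm q > 1" and U: "open U" "0 \<notin> U" "(\<lambda>z. inverse q * z) ` U \<subseteq> U"
    and f: "f holomorphic_on U" and a: "has_q_asymptotic_expansion q U f a"
    and K: "invariant_strict_subset q U K"
  shows "\<exists>F\<in>ker_dbar (K \<union> {0}). \<forall>z\<in>K. f z = F (0, 0) z"
proof -
  have q0: "q \<noteq> 0" using q by auto
  obtain A where A: "compact A" "A \<subseteq> U" "K = q_orbit q A"
    using K unfolding invariant_strict_subset_iff by blast
  have orb: "q_orbit q B \<subseteq> U" if "B \<subseteq> U" for B by (rule q_orbit_subset[OF U(3) that])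
  have KU: "K \<subseteq> U" using orb A by blast
  obtain \<psi> S V \<rho> where S: "compact S" "S \<subseteq> U" and \<psi>S': "\<forall>z. \<psi> z \<noteq> (0::complex) \<longrightarrow> z \<in> q_orbit q S"
    and V: "open V" "q_orbit q A \<subseteq> V" and \<psi>V': "\<forall>z\<in>V. \<psi> z = 1"
    and \<psi>C': "\<forall>k. Ck_on k (UNIV - {0}) \<psi>" and \<rho>: "\<rho> > 0"
    and \<psi>B': "\<forall>k. \<exists>C\<ge>0. symbol_bound k 0 C (ball 0 \<rho> - {0}) \<psi>"
    using ex_invariant_cutoff[OF q U(1,2) A(1,2)] by (elim exE conjE)
  note \<psi>S = \<psi>S'[rule_format] and \<psi>V = \<psi>V'[rule_format] and \<psi>C = \<psi>C'[rule_format] and \<psi>B = \<psi>B'[rule_format]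
  \<comment> \<open>Symbol estimates and gluing need an open set around the support of \<psi>, and
    the estimates of \<open>f\<close> need a compact set whose orbit contains that open set.\<close>
  obtain S1 V1 where S1: "compact S1" "S1 \<subseteq> U" and V1: "open V1" "S \<subseteq> V1" "V1 \<subseteq> S1"
    by (rule ex_compact_nhd[OF S(1) U(1) S(2)])
  define W where "W = q_orbit q V1"
  have W: "open W" "q_orbit q S \<subseteq> W" "W \<subseteq> q_orbit q S1"
    unfolding W_def by (intro open_q_orbit q0 q_orbit_mono V1)+
  have WU: "W \<subseteq> U" using W(3) orb[OF S1(2)] by blast
  \<comment> \<open>On \<open>Z\<close> the correction \<open>u\<close> is 0. Together with
    \<open>U\<close> it covers the punctured plane, so smoothness of \<open>g\<close> off 0 is
    checked on these two open sets.\<close>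
  define Z where "Z = UNIV - {0} - q_orbit q S"
  have Z: "open Z" unfolding Z_def by (rule open_compl_q_orbit[OF q S(1)])
  define T where "T n z = (\<Sum>p<n. fps_nth a p * z ^ p)" for n z
  have T_hol: "T n holomorphic_on X" for n X unfolding T_def by (intro holomorphic_intros)
  obtain h where hC: "\<And>k. Ck_on k (UNIV - {0}) h"
    and hB: "\<And>n k. \<exists>\<epsilon>>0. \<exists>C\<ge>0. symbol_bound k (int n) C (ball 0 \<epsilon> - {0}) (\<lambda>z. h z - T n z)"
    using ex_borel_sum[of "fps_nth a"] unfolding T_def by blast
  define u where "u z = \<psi> z * (f z - h z)" for z
  \<comment> \<open>At 0 the constant term of the expansion is prescribed. Off \<open>U\<close>,
    where \<open>f\<close> has arbitrary values, \<psi> vanishes.\<close>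
  define g where "g z = (if z = 0 then fps_nth a 0 else h z + u z)" for z
  have u0: "u z = 0" if "z \<in> Z" for z
    using \<psi>S[of z] that by (auto simp: u_def Z_def)
  have fB: "\<exists>C\<ge>0. symbol_bound k (int n) C W (\<lambda>z. f z - T n z)" for k n
  proof (rule orbit_decay_imp_symbol_bound[OF q U _ _ S1 W(1,3)])
    show "(\<lambda>z. f z - T n z) holomorphic_on U" by (intro holomorphic_on_diff f T_hol)
    fix B assume B: "compact B" "B \<subseteq> U"
    then have "0 \<notin> q_orbit q B" using orb[of B] U(2) by blast
    then show "\<exists>C. \<forall>z\<in>q_orbit q B. norm (f z - T n z) \<le> C * norm z powi int n"
      unfolding T_def by (rule q_asymptotic_imp_orbit_decay[OF a B])
  qed
  have gC: "Ck_on k (UNIV - {0}) g" for k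
  proof -
    have sub: "U \<subseteq> UNIV - {0}" "Z \<subseteq> UNIV - {0}" using U(2) by (auto simp: Z_def)
    have "Ck_on k U (\<lambda>z. h z + \<psi> z * (f z - h z))"
      by (intro Ck_on_add Ck_on_mult Ck_on_diff U(1) Ck_on_mono[OF hC sub(1)] Ck_on_mono[OF \<psi>C sub(1)]
          Ck_on_holomorphic f)
    then have 1: "Ck_on k U g"
      by (rule Ck_on_cong[OF U(1), rotated]) (use U(2) in \<open>auto simp: g_def u_def\<close>)
    have 2: "Ck_on k Z g"
      by (rule Ck_on_cong[OF Z _ Ck_on_mono[OF hC sub(2)]]) (use u0 sub(2) in \<open>auto simp: g_def\<close>)
    have "UNIV - {0} \<subseteq> U \<union> Z" using orb[OF S(2)] by (auto simp: Z_def)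
    then show ?thesis using Ck_on_mono[OF Ck_on_Un[OF U(1) Z 1 2]] by blast
  qed
  have gB: "\<exists>\<epsilon>>0. \<exists>C. symbol_bound k (int n) C (ball 0 \<epsilon> - {0}) (\<lambda>z. g z - T n z)" for k n
  proof -
    obtain \<epsilon>h Ch where h: "\<epsilon>h > 0" "Ch \<ge> 0" "symbol_bound k (int n) Ch (ball 0 \<epsilon>h - {0}) (\<lambda>z. h z - T n z)"
      using hB by blast
    obtain C\<psi> where c: "C\<psi> \<ge> 0" "symbol_bound k 0 C\<psi> (ball 0 \<rho> - {0}) \<psi>" using \<psi>B by blast
    obtain Cf where cf: "Cf \<ge> 0" "symbol_bound k (int n) Cf W (\<lambda>z. f z - T n z)" using fB by blast
    define \<epsilon> where "\<epsilon> = min \<epsilon>h \<rho>"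
    define B where "B = ball (0::complex) \<epsilon> - {0}"
    have B: "open B" unfolding B_def by (intro open_delete open_ball)
    have sub: "B \<subseteq> ball 0 \<epsilon>h - {0}" "B \<subseteq> ball 0 \<rho> - {0}" by (auto simp: B_def \<epsilon>_def)
    have BW: "open (B \<inter> W)" by (intro open_Int B W)
    define D where "D = 2 ^ k * C\<psi> * (Cf + Ch * norm (- 1::complex))"
    \<comment> \<open>The polynomial \<open>T n\<close> cancels in f - h. Since \<open>n\<close> is
      arbitrary, f - h is flat to every order on \<open>W\<close>, and the order-0 factor \<psi>
      preserves this.\<close>
    have "symbol_bound k (0 + int n) D (B \<inter> W) (\<lambda>z. \<psi> z * ((f z - T n z) + - 1 * (h z - T n z)))"
      unfolding D_def
    proof (rule symbol_bound_mult[OF BW])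
      show "0 \<notin> B \<inter> W" by (simp add: B_def)
      show "symbol_bound k 0 C\<psi> (B \<inter> W) \<psi>" using sub(2) by (intro symbol_bound_subset[OF c(2)]) auto
      show "symbol_bound k (int n) (Cf + Ch * norm (- 1::complex)) (B \<inter> W) (\<lambda>z. (f z - T n z) + - 1 * (h z - T n z))"
        using sub(1)
        by (intro symbol_bound_add symbol_bound_cmult BW symbol_bound_subset[OF cf(2)] symbol_bound_subset[OF h(3)]) auto
    qed (use c cf h in auto)
    then have 1: "symbol_bound k (int n) D (B \<inter> W) u"
      by (intro symbol_bound_cong[OF BW order.refl, of _ u]) (auto simp: u_def algebra_simps)
    have D: "D \<ge> 0" unfolding D_def using c cf h by simp
    have 2: "symbol_bound k (int n) D (B \<inter> Z) u"
      by (rule symbol_bound_cong[OF Z _ _ symbol_bound_0[OF D]]) (use u0 in auto)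
    have "B \<subseteq> (B \<inter> W) \<union> (B \<inter> Z)" using W(2) by (auto simp: B_def Z_def)
    with symbol_bound_Un[OF 1 2] have "symbol_bound k (int n) D B u" by (rule symbol_bound_subset)
    then have "symbol_bound k (int n) (Ch + D) B (\<lambda>z. (h z - T n z) + u z)"
      by (intro symbol_bound_add B symbol_bound_subset[OF h(3) sub(1)])
    then have "symbol_bound k (int n) (Ch + D) B (\<lambda>z. g z - T n z)"
      by (rule symbol_bound_cong[OF B order.refl, rotated]) (auto simp: g_def B_def)
    then show ?thesis using h(1) \<rho> unfolding B_def by (intro exI[of _ \<epsilon>] conjI exI[of _ "Ch + D"]) (auto simp: \<epsilon>_def)
  qed
  \<comment> \<open>With \<open>T (Suc k)\<close> the remainder has order k + 1, which just exceeds
    \<open>k\<close> as \<open>symbol_bound_extend\<close> demands.\<close>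
  have at0: "\<exists>\<epsilon>>0. Ck_on k (ball 0 \<epsilon>) g \<and> (\<forall>i j. i + j \<le> k \<longrightarrow>
      partial_deriv (i, j) g 0 = partial_deriv (i, j) (T (Suc k)) 0)" for k
  proof -
    obtain \<epsilon> C where \<epsilon>: "\<epsilon> > 0" and sb: "symbol_bound k (int (Suc k)) C (ball 0 \<epsilon> - {0}) (\<lambda>z. g z - T (Suc k) z)"
      using gB by blast
    define e where "e z = g z - T (Suc k) z" for z
    have "T (Suc k) 0 = fps_nth a 0" by (simp add: T_def sum.lessThan_Suc_shift)
    then have e0: "e 0 = 0" by (simp add: e_def g_def)
    have e: "Ck_on k (ball 0 \<epsilon>) e" "\<And>i j. i + j \<le> k \<Longrightarrow> partial_deriv (i, j) e 0 = 0"
      using symbol_bound_extend[OF sb[folded e_def] e0 _ \<epsilon>] by auto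
    have T: "Ck_on m (ball 0 \<epsilon>) (T (Suc k))" for m by (intro Ck_on_holomorphic open_ball T_hol)
    have g: "g = (\<lambda>z. T (Suc k) z + e z)" by (auto simp: e_def)
    have "Ck_on k (ball 0 \<epsilon>) g" unfolding g by (intro Ck_on_add open_ball T e)
    moreover have "partial_deriv (i, j) g 0 = partial_deriv (i, j) (T (Suc k)) 0" if "i + j \<le> k" for i j
      unfolding g using partial_deriv_add[OF open_ball _ T Ck_on_le[OF e(1) that], of 0] e(2)[OF that] \<epsilon> by simp
    ultimately show ?thesis using \<epsilon> by blast
  qed
  have smooth: "smooth_on UNIV g"
    unfolding smooth_on_def
  proof
    fix k
    obtain \<epsilon> where "\<epsilon> > 0" "Ck_on k (ball 0 \<epsilon>) g" using at0 by blast
    then have "Ck_on k (ball 0 \<epsilon> \<union> (UNIV - {0})) g"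
      by (intro Ck_on_Un gC open_ball open_delete open_UNIV)
    moreover have "ball 0 \<epsilon> \<union> (UNIV - {0}) = (UNIV :: complex set)" using \<open>\<epsilon> > 0\<close> by auto
    ultimately show "Ck_on k UNIV g" by simp
  qed
  have gf: "g z = f z" if "z \<in> V \<inter> U" for z
    using that \<psi>V[of z] U(2) by (auto simp: g_def u_def)
  have flatK: "jet_dbar_flat g z" if "z \<in> K" for z
  proof (rule jet_dbar_flat_cong)
    show "open (V \<inter> U)" "z \<in> V \<inter> U" using V U A(3) KU that by auto
    show "jet_dbar_flat f z"
      by (rule jet_dbar_flat_holomorphic[OF U(1) f]) (use KU that in blast)
  qed (use gf in auto)
  have flat0: "jet_dbar_flat g 0"
    unfolding jet_dbar_flat_def
  proof (intro allI)
    fix i j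
    \<comment> \<open>Both derivatives have total order i + j + 1, so they can be read off the same
      polynomial, which is holomorphic.\<close>
    have "partial_deriv (Suc i, j) g 0 = partial_deriv (Suc i, j) (T (Suc (Suc (i + j)))) 0"
      "partial_deriv (i, Suc j) g 0 = partial_deriv (i, Suc j) (T (Suc (Suc (i + j)))) 0"
      using at0[of "Suc (i + j)"] by auto
    then show "partial_deriv (Suc i, j) g 0 + \<i> * partial_deriv (i, Suc j) g 0 = 0"
      using jet_dbar_flat_holomorphic[OF open_UNIV T_hol] unfolding jet_dbar_flat_def by auto
  qed
  define F where "F = (\<lambda>k z. if z \<in> K \<union> {0} then partial_deriv k g z else 0)"
  have "F \<in> ker_dbar (K \<union> {0})"
    unfolding mem_ker_dbar_iff using smooth flatK flat0 F_def
    by (intro exI[of _ UNIV] exI[of _ g]) auto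
  moreover have "f z = F (0, 0) z" if "z \<in> K" for z
  proof -
    have "z \<in> V \<inter> U" using that V(2) KU A(3) by blast
    then show ?thesis using gf[of z] that by (simp add: F_def)
  qed
  ultimately show ?thesis by blast
qed

section \<open>From jets to expansions\<close>

lemma jets_imp_holomorphic:
  assumes U: "open U"
    and jets: "\<And>K. invariant_strict_subset q U K \<Longrightarrow> \<exists>F\<in>ker_dbar (K \<union> {0}). \<forall>z\<in>K. f z = F (0, 0) z"
  shows "f holomorphic_on U"
  unfolding holomorphic_on_open[OF U]
proof
  fix z assume "z \<in> U"
  then obtain r where r: "r > 0" "cball z r \<subseteq> U" using U open_contains_cball by blast
  \<comment> \<open>The representative \<open>g\<close> is tied to \<open>f\<close> only on
    \<open>K\<close>, so \<open>K\<close> is chosen with z in its interior. Then the complex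
    derivative of \<open>g\<close> at z is also that of \<open>f\<close>.\<close>
  define K where "K = q_orbit q (cball z r)"
  have "invariant_strict_subset q U K"
    unfolding invariant_strict_subset_iff K_def using r by (intro exI[of _ "cball z r"]) auto
  then obtain F where F: "F \<in> ker_dbar (K \<union> {0})" "\<And>w. w \<in> K \<Longrightarrow> f w = F (0, 0) w"
    using jets by blast
  then obtain V g where g: "open V" "K \<union> {0} \<subseteq> V" "smooth_on V g" "\<forall>w\<in>K \<union> {0}. jet_dbar_flat g w"
      "F = (\<lambda>k w. if w \<in> K \<union> {0} then partial_deriv k g w else 0)"
    unfolding mem_ker_dbar_iff by blast
  have ball: "ball z r \<subseteq> K" unfolding K_def using subset_q_orbit[of "cball z r" q] by auto
  have z: "z \<in> ball z r" using r by simp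
  have "Ck_on (Suc 0) V g" using g(3) unfolding smooth_on_def by blast
  moreover have zK: "z \<in> K" using ball z by blast
  then have "z \<in> V" using g(2) by blast
  ultimately have "g differentiable (at z)" by simp
  moreover have "jet_dbar_flat g z" using g(4) zK by blast
  ultimately have "(g has_field_derivative partial_x g z) (at z)"
    by (rule jet_dbar_flat_has_field_derivative)
  then have "(f has_field_derivative partial_x g z) (at z)"
  proof (rule has_field_derivative_transform_within_open[OF _ open_ball z])
    show "g w = f w" if "w \<in> ball z r" for w
      using F(2)[of w] ball that g(5) by auto
  qed
  then show "\<exists>f'. (f has_field_derivative f') (at z)" by blast
qed

text \<open>Near 0 the Taylor estimate of the representative bounds the quotient; the rest of
  \<open>K\<close> lies in a compact subset of \<open>U\<close>, where continuity suffices. The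
  coefficients come from the representative, so here they may still depend on
  \<open>K\<close>.\<close>

lemma jets_imp_bounded_remainders:
  assumes q: "norm q > 1" and U: "open U" "0 \<notin> U" "(\<lambda>z. inverse q * z) ` U \<subseteq> U"
    and f: "f holomorphic_on U" and K: "invariant_strict_subset q U K"
    and F: "F \<in> ker_dbar (K \<union> {0})" "\<And>z. z \<in> K \<Longrightarrow> f z = F (0, 0) z"
  shows "\<exists>a. \<forall>n. bounded ((\<lambda>z. inverse (z ^ n) * (f z - (\<Sum>p<n. fps_nth a p * z ^ p))) ` K)"
proof -
  obtain A where A: "compact A" "A \<subseteq> U" "K = q_orbit q A"
    using K unfolding invariant_strict_subset_iff by blast
  have KU: "K \<subseteq> U" unfolding A(3) by (rule q_orbit_subset[OF U(3) A(2)])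
  obtain V g where g: "open V" "K \<union> {0} \<subseteq> V" "smooth_on V g" "\<forall>w\<in>K \<union> {0}. jet_dbar_flat g w"
      "F = (\<lambda>k w. if w \<in> K \<union> {0} then partial_deriv k g w else 0)"
    using F(1) unfolding mem_ker_dbar_iff by blast
  have fg: "f z = g z" if "z \<in> K" for z using F(2)[OF that] g(5) that by simp
  define a where "a = Abs_fps (\<lambda>p. partial_deriv (p, 0) g 0 / fact p)"
  have "bounded ((\<lambda>z. inverse (z ^ n) * (f z - (\<Sum>p<n. fps_nth a p * z ^ p))) ` K)" for n
  proof -
    define R where "R z = inverse (z ^ n) * (f z - (\<Sum>p<n. fps_nth a p * z ^ p))" for z
    have "\<exists>\<epsilon>>0. \<exists>C. \<forall>z\<in>ball 0 \<epsilon>. norm (g z - (\<Sum>p<n. fps_nth a p * z ^ p)) \<le> C * norm z ^ n"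
      using jet_dbar_flat_taylor[OF g(1) _ g(3), of n] g(2,4) by (simp add: a_def)
    then obtain \<epsilon> C where \<epsilon>: "\<epsilon> > 0"
      "\<And>z. z \<in> ball 0 \<epsilon> \<Longrightarrow> norm (g z - (\<Sum>p<n. fps_nth a p * z ^ p)) \<le> C * norm z ^ n"
      by blast
    obtain M where M: "compact M" "M \<subseteq> q_orbit q A" "\<And>z. z \<in> q_orbit q A \<Longrightarrow> norm z \<ge> \<epsilon> \<Longrightarrow> z \<in> M"
      using q_orbit_compact_part[OF q A(1) \<epsilon>(1)] by blast
    have MU: "M \<subseteq> U" using M(2) KU A(3) by blast
    have "continuous_on M R"
      unfolding R_def using MU U(2) holomorphic_on_imp_continuous_on[OF f]
      by (intro continuous_intros) (auto intro: continuous_on_subset)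
    then have bM: "bounded (R ` M)"
      using M(1) compact_continuous_image compact_imp_bounded by blast
    have bB: "bounded (R ` (K \<inter> ball 0 \<epsilon>))"
      unfolding bounded_iff
    proof (intro exI ballI)
      fix w assume "w \<in> R ` (K \<inter> ball 0 \<epsilon>)"
      then obtain z where z: "z \<in> K" "z \<in> ball 0 \<epsilon>" "w = R z" by blast
      have "z \<noteq> 0" using z(1) KU U(2) by blast
      then have "norm z ^ n > 0" by simp
      then show "norm w \<le> C"
        using \<epsilon>(2)[OF z(2)] unfolding z(3) R_def fg[OF z(1)]
        by (simp add: norm_mult norm_inverse norm_divide norm_power field_simps)
    qed
    have "K \<subseteq> M \<union> (K \<inter> ball 0 \<epsilon>)" using M(3) A(3) by (force simp: not_less)
    then have "R ` K \<subseteq> R ` M \<union> R ` (K \<inter> ball 0 \<epsilon>)" by blast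
    then have "bounded (R ` K)" using bM bB bounded_subset bounded_Un by metis
    then show ?thesis unfolding R_def .
  qed
  then show ?thesis by blast
qed

text \<open>A single orbit tending to 0 determines the expansion: if all coefficients below
  \<open>p\<close> agree, subtracting the two remainders of order p + 1 shows that (a_p - b_p)/z is
  bounded along the orbit.\<close>

lemma asymptotic_coefficients_unique:
  assumes q: "norm q > 1" and z0: "z0 \<noteq> 0"
    and a: "\<And>n. bounded ((\<lambda>z. inverse (z ^ n) * (f z - (\<Sum>p<n. fps_nth a p * z ^ p))) ` q_orbit q {z0})"
    and b: "\<And>n. bounded ((\<lambda>z. inverse (z ^ n) * (f z - (\<Sum>p<n. fps_nth b p * z ^ p))) ` q_orbit q {z0})"
  shows "a = b"
proof -
  have q0: "q \<noteq> 0" using q by auto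
  have "fps_nth a p = fps_nth b p" for p
  proof (induction p rule: less_induct)
    case (less p)
    obtain A where A: "\<And>z. z \<in> q_orbit q {z0} \<Longrightarrow> norm (inverse (z ^ Suc p) * (f z - (\<Sum>p<Suc p. fps_nth a p * z ^ p))) \<le> A"
      using a[of "Suc p"] unfolding bounded_iff by blast
    obtain B where B: "\<And>z. z \<in> q_orbit q {z0} \<Longrightarrow> norm (inverse (z ^ Suc p) * (f z - (\<Sum>p<Suc p. fps_nth b p * z ^ p))) \<le> B"
      using b[of "Suc p"] unfolding bounded_iff by blast
    define d where "d = norm (fps_nth a p - fps_nth b p)"
    \<comment> \<open>At z = q^(-m) z0 the bound d \<le> (A + B) |z| reads as stated; letting m grow
      forces d = 0.\<close>
    have bound: "d * norm q ^ m \<le> (A + B) * norm z0" for m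
    proof -
      define z where "z = inverse q ^ m * z0"
      have z: "z \<in> q_orbit q {z0}" "z \<noteq> 0" unfolding q_orbit_def z_def using z0 q0 by auto
      define Ta where "Ta = (\<Sum>i<p. fps_nth a i * z ^ i)"
      have Tb: "(\<Sum>i<p. fps_nth b i * z ^ i) = Ta" unfolding Ta_def using less by (intro sum.cong) auto
      have "inverse (z ^ Suc p) * (f z - (\<Sum>p<Suc p. fps_nth b p * z ^ p))
          - inverse (z ^ Suc p) * (f z - (\<Sum>p<Suc p. fps_nth a p * z ^ p))
          = inverse (z ^ Suc p) * ((fps_nth a p - fps_nth b p) * z ^ p)"
        by (simp add: Tb flip: Ta_def) (simp add: algebra_simps)
      also have "\<dots> = (fps_nth a p - fps_nth b p) / z" using z(2) by (simp add: field_simps)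
      finally have "norm ((fps_nth a p - fps_nth b p) / z) \<le> B + A"
        using order.trans[OF norm_triangle_ineq4 add_mono[OF B[OF z(1)] A[OF z(1)]]] by metis
      then have "d \<le> (A + B) * norm z" using z(2) by (simp add: d_def norm_divide field_simps)
      also have "norm z = norm z0 / norm q ^ m"
        by (simp add: z_def norm_mult norm_power norm_inverse power_inverse divide_inverse mult.commute)
      finally show ?thesis using q0 by (simp add: field_simps)
    qed
    have "d = 0"
    proof (rule ccontr)
      assume "d \<noteq> 0"
      then have d: "d > 0" by (simp add: d_def)
      obtain m where "(A + B) * norm z0 / d < norm q ^ m" using real_arch_pow[OF q] by blast
      then show False using bound[of m] d by (simp add: field_simps)
    qed
    then show ?case by (simp add: d_def)
  qed
  then show ?thesis by (simp add: fps_eq_iff)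
qed

theorem proposition4p1p3:
  fixes q :: complex and U :: "complex set" and f :: "complex \<Rightarrow> complex"
  assumes "norm q > 1"
    and "open U"
    and "0 \<notin> U"
    and "(\<lambda>z. inverse q * z) ` U \<subseteq> U"
  shows "f \<in> q_asymptotic_functions q U \<longleftrightarrow>
    (\<forall>K. invariant_strict_subset q U K \<longrightarrow>
       (\<exists>F \<in> ker_dbar (K \<union> {0}). \<forall>z\<in>K. f z = F (0, 0) z))"
proof
  assume "f \<in> q_asymptotic_functions q U"
  then show "\<forall>K. invariant_strict_subset q U K \<longrightarrow>
       (\<exists>F \<in> ker_dbar (K \<union> {0}). \<forall>z\<in>K. f z = F (0, 0) z)"
    using q_asymptotic_imp_jets[OF assms] unfolding q_asymptotic_functions_def by blast
next
  assume jets: "\<forall>K. invariant_strict_subset q U K \<longrightarrow>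
       (\<exists>F \<in> ker_dbar (K \<union> {0}). \<forall>z\<in>K. f z = F (0, 0) z)"
  have f: "f holomorphic_on U" using jets_imp_holomorphic[OF assms(2)] jets by blast
  define rem_bounded where "rem_bounded K a \<longleftrightarrow>
    (\<forall>n. bounded ((\<lambda>z. inverse (z ^ n) * (f z - (\<Sum>p<n. fps_nth a p * z ^ p))) ` K))" for K a
  have ex: "\<exists>a. rem_bounded K a" if K: "invariant_strict_subset q U K" for K
  proof -
    obtain F where F: "F \<in> ker_dbar (K \<union> {0})" "\<forall>z\<in>K. f z = F (0, 0) z" using jets K by blast
    show ?thesis unfolding rem_bounded_def
      by (rule jets_imp_bounded_remainders[OF assms f K F(1)]) (use F(2) in blast)
  qed
  have mono: "rem_bounded L a" if "rem_bounded K a" "L \<subseteq> K" for K L a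
    using that unfolding rem_bounded_def by (meson bounded_subset image_mono)
  have "\<exists>a. \<forall>K. invariant_strict_subset q U K \<longrightarrow> rem_bounded K a"
  \<comment> \<open>Coefficients are fixed once and for all by the orbit of a base point in
    \<open>U\<close>; an empty \<open>U\<close> has no base point, and there every series
    serves.\<close>
  proof (cases "U = {}")
    case True
    then have "K = {}" if "invariant_strict_subset q U K" for K
      using that unfolding invariant_strict_subset_def by auto
    then show ?thesis by (auto simp: rem_bounded_def)
  next
    case False
    then obtain z0 where z0: "z0 \<in> U" by blast
    then have "invariant_strict_subset q U (q_orbit q {z0})"
      unfolding invariant_strict_subset_iff by (intro exI[of _ "{z0}"]) auto
    then obtain a where a: "rem_bounded (q_orbit q {z0}) a" using ex by blast
    have "rem_bounded K a" if K: "invariant_strict_subset q U K" for K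
    proof -
      obtain A where A: "compact A" "A \<subseteq> U" "K = q_orbit q A"
        using K unfolding invariant_strict_subset_iff by blast
      \<comment> \<open>Adjoining the base point gives a common superset: its series
        \<open>b\<close> works on \<open>K\<close> and, by uniqueness on the base orbit, equals
        \<open>a\<close>.\<close>
      have "invariant_strict_subset q U (q_orbit q (A \<union> {z0}))"
        unfolding invariant_strict_subset_iff using A z0 by (intro exI[of _ "A \<union> {z0}"]) auto
      then obtain b where b: "rem_bounded (K \<union> q_orbit q {z0}) b"
        using ex unfolding q_orbit_Un A(3) by blast
      have "z0 \<noteq> 0" using z0 assms(3) by blast
      moreover have "rem_bounded (q_orbit q {z0}) b" by (rule mono[OF b]) blast
      ultimately have "a = b"
        using a unfolding rem_bounded_def by (intro asymptotic_coefficients_unique[OF assms(1)]) auto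
      then show ?thesis using mono[OF b] by blast
    qed
    then show ?thesis by blast
  qed
  then show "f \<in> q_asymptotic_functions q U"
    using f unfolding q_asymptotic_functions_def has_q_asymptotic_expansion_def rem_bounded_def by blast
qed

end
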